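(* Let $q$ be an odd prime power such that $q-1$ is squarefree, and let $m \ge 2$. Suppose that for every partition $\lambda$ of $m$, with $\ell(\lambda)$ parts, every element of the set $\{c \in \mathbb{F}_q^\times : \chi_q(c) = (-1)^{m-\ell(\lambda)}\}$ is the discriminant of the same number of polynomials in $S_{\lambda,\mathbb{F}_q}$. Then $\gcd(q-1, m(m-1)) = 2$.
   Context: For a partition $\lambda = (\lambda_1,\dots,\lambda_k)$ of $m$ (so $\ell(\lambda)=k$), a monic $f \in \mathbb{F}_q[x]$ of degree $m$ has factorization type $\lambda$ if $f = \pi_1\cdots\pi_k$ with the $\pi_i$ distinct monic irreducible polynomials and $\deg \pi_i = \lambda_i$. $S_{\lambda,\mathbb{F}_q}$ is the set of monic squarefree polynomials in $\mathbb{F}_q[x]$ of factorization type $\lambda$. $\chi_q$ is the quadratic character of $\mathbb{F}_q^\times$. For $f$ of degree $m\ge 2$ with leading coefficient $a_m$ and roots $\alpha_i$ in a splitting field, $\operatorname{disc}(f) = a_m^{2m-2}\prod_{i<j}(\alpha_i-\alpha_j)^2$. *)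

theory Defs
  imports "HOL-Algebra.Algebraic_Closure_Type"
          "HOL-Computational_Algebra.Computational_Algebra"
begin

definition quad_char :: "'a::field \<Rightarrow> int" where
  "quad_char c = (if c = 0 then 0 else if (\<exists>y. y ^ 2 = c) then 1 else -1)"

definition is_partition :: "nat \<Rightarrow> nat multiset \<Rightarrow> bool" where
  "is_partition m lam \<longleftrightarrow> (\<forall>x\<in>#lam. 0 < x) \<and> sum_mset lam = m"

definition has_fact_type :: "'a::field poly \<Rightarrow> nat multiset \<Rightarrow> bool" where
  "has_fact_type f lam \<longleftrightarrow>
     (\<exists>ps. distinct ps \<and> (\<forall>p\<in>set ps. lead_coeff p = 1 \<and> Factorial_Ring.irreducible p)
          \<and> f = prod_list ps \<and> mset (map degree ps) = lam)"

definition S_type :: "nat multiset \<Rightarrow> 'a::field poly set" where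
  "S_type lam = {f. lead_coeff f = 1 \<and> squarefree f \<and> has_fact_type f lam}"

definition disc_ac :: "'a::field poly \<Rightarrow> 'a alg_closure" where
  "disc_ac f = (let m = degree f;
                    rs = (SOME rs. length rs = m \<and>
                       map_poly to_ac f = smult (to_ac (lead_coeff f)) (\<Prod>r\<leftarrow>rs. [:-r, 1:]))
                in to_ac (lead_coeff f) ^ (2 * m - 2) *
                   (\<Prod>(i, j)\<in>{(i, j). i < j \<and> j < m}. (rs ! i - rs ! j) ^ 2))"

text \<open>The discriminant lies in the base field; we take it back there.\<close>
definition disc :: "'a::field poly \<Rightarrow> 'a" where
  "disc f = of_ac (disc_ac f)"

end

theory Submission
  imports Defs "HOL-Number_Theory.Totient"
begin

text \<open>
  By Stickelberger's theorem the discriminants of the elements of \<open>S_type lam\<close> all lie in the class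
  of \<open>(q - 1) / 2\<close> elements prescribed by the parity of \<open>m - size lam\<close>, so equidistribution forces
  \<open>(q - 1) / 2\<close> to divide \<open>card (S_type lam)\<close>. If the gcd is not \<open>2\<close>, squarefreeness of \<open>q - 1\<close> yields
  an odd prime \<open>l\<close> dividing \<open>q - 1\<close> exactly once and dividing \<open>m\<close> or \<open>m - 1\<close>. Let \<open>lam\<close> consist of the
  nonzero terms \<open>b * l ^ a\<close> of the base \<open>l\<close> expansion of \<open>m\<close>, whose last digit is \<open>0\<close> or \<open>1\<close>. These
  parts are distinct, so \<open>card (S_type lam)\<close> is the product of the numbers of monic irreducible
  polynomials of these degrees. The number \<open>N n\<close> of monic irreducibles of degree \<open>n\<close> satisfies
  \<open>b * N (b * l ^ a) = - totient b * (q - 1) / l\<close> modulo \<open>l\<close> for \<open>a > 0\<close>, so none of the factors is divisible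
  by \<open>l\<close>, a contradiction.
\<close>

subsection \<open>The Frobenius automorphism of the algebraic closure\<close>

text \<open>Multiplication by a nonzero \<open>x\<close> permutes the nonzero elements, so their
  product cancels; the extra factor \<open>x\<close> on both sides raises the exponent from q - 1 to
  q, the field size.\<close>

lemma finite_field_power_card:
  fixes x :: "'a::{field,finite}"
  shows "x ^ card (UNIV :: 'a set) = x"
proof (cases "x = 0")
  case False
  have "x * (\<Prod>y\<in>UNIV-{0}. x * y) = x * x ^ (card (UNIV :: 'a set) - 1) * \<Prod>(UNIV-{0})"
    by (simp add: prod.distrib mult_ac)
  also have "x * x ^ (card (UNIV :: 'a set) - 1) = x ^ Suc (card (UNIV :: 'a set) - 1)"
    by simp
  also have "Suc (card (UNIV :: 'a set) - 1) = card (UNIV :: 'a set)"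
    by (simp add: card_gt_0_iff)
  also have "(\<Prod>y\<in>UNIV-{0}. x * y) = (\<Prod>y\<in>UNIV-{0}. y)"
    by (rule prod.reindex_bij_witness[of _ "\<lambda>y. y / x" "\<lambda>y. x * y"]) (use False in auto)
  finally show ?thesis
    by simp
qed (simp add: card_gt_0_iff)

text \<open>Translation by 1 permutes the ring and so preserves the sum of all its elements.\<close>

lemma of_nat_card_UNIV_eq_0: "of_nat (card (UNIV :: 'a set)) = (0 :: 'a::{ring_1,finite})"
proof -
  have "(\<Sum>x\<in>(UNIV :: 'a set). x) = (\<Sum>x\<in>(UNIV :: 'a set). x + 1)"
    by (rule sum.reindex_bij_witness[of _ "\<lambda>x. x + 1" "\<lambda>x. x - 1"]) auto
  then show ?thesis
    by (simp add: sum.distrib)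
qed

lemma card_field_ge_2: "card (UNIV :: 'a::{field,finite} set) \<ge> 2"
  using card_mono[of "UNIV :: 'a set" "{0, 1}"] by simp

definition frob :: "'a::{field,finite} alg_closure \<Rightarrow> 'a alg_closure" where
  "frob x = x ^ card (UNIV :: 'a set)"

lemma card_range_to_ac [simp]:
  "card (range (to_ac :: 'a::{field,finite} \<Rightarrow> 'a alg_closure)) = card (UNIV :: 'a set)"
  by (simp add: card_image inj_to_ac)

lemma frob_to_ac [simp]: "frob (to_ac c) = to_ac c"
  by (simp add: frob_def finite_field_power_card flip: to_ac_power)

lemma frob_mult: "frob (x * y) = frob x * frob y"
  by (simp add: frob_def power_mult_distrib)

text \<open>
  Both sides are polynomials in each of the variables with the same leading term, so it suffices
  to compare them on the base field, first in one variable and then in the other.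
\<close>
lemma frob_add: "frob (x + y) = frob x + frob (y :: 'a::{field,finite} alg_closure)"
proof -
  define q where "q = card (UNIV :: 'a set)"
  have q: "q \<ge> 2"
    using card_field_ge_2 by (simp add: q_def)
  define A where "A = range (to_ac :: 'a \<Rightarrow> 'a alg_closure)"
  \<comment> \<open>Both sides have coefficient 1 at degree \<open>q\<close>, so their difference
    has degree below \<open>q\<close>; it vanishes at the \<open>q\<close> elements of
    \<open>A\<close>.\<close>
  have step: "[:z, 1:] ^ q = Polynomial.monom 1 q + [:z ^ q:]"
    if "\<And>a. a \<in> A \<Longrightarrow> (z + a) ^ q = z ^ q + a ^ q" for z :: "'a alg_closure"
  proof (rule poly_eqI_degree_lead_coeff[where n = q and A = A])
    show "Polynomial.coeff ([:z, 1:] ^ q) q = Polynomial.coeff (Polynomial.monom 1 q + [:z ^ q:]) q"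
      using q by (simp add: coeff_linear_power coeff_pCons split: nat.split)
    show "degree (Polynomial.monom 1 q + [:z ^ q:]) \<le> q"
      by (intro degree_add_le) (auto simp: degree_monom_le)
  qed (use that in \<open>auto simp: A_def q_def degree_linear_power poly_monom algebra_simps\<close>)
  have base: "(to_ac b + a) ^ q = to_ac b ^ q + a ^ q" if "a \<in> A" for b and a :: "'a alg_closure"
    using that finite_field_power_card[where ?'a = 'a]
    by (auto simp: A_def q_def simp flip: to_ac_power to_ac_add)
  \<comment> \<open>The roles are exchanged: the constant of the linear polynomial is now
    \<open>a\<close> from the base field, and the identity is evaluated at an arbitrary
    \<open>z\<close>.\<close>
  have "(z + a) ^ q = z ^ q + a ^ q" if a: "a \<in> A" for z a :: "'a alg_closure"
  proof -
    obtain b where b: "a = to_ac b"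
      using a by (auto simp: A_def)
    from step[of a] base[of _ b] b have "poly ([:a, 1:] ^ q) z = poly (Polynomial.monom 1 q + [:a ^ q:]) z"
      by simp
    then show ?thesis
      by (simp add: poly_monom algebra_simps)
  qed
  from step[OF this, of x] have "poly ([:x, 1:] ^ q) y = poly (Polynomial.monom 1 q + [:x ^ q:]) y"
    by simp
  then show ?thesis
    by (simp add: poly_monom frob_def q_def algebra_simps)
qed

lemma frob_0 [simp]: "frob 0 = 0"
  by (simp add: frob_def card_gt_0_iff)

lemma frob_1 [simp]: "frob 1 = 1"
  by (simp add: frob_def)

lemma frob_minus: "frob (- x) = - frob x"
  using frob_add[of x "- x"] by (simp add: eq_neg_iff_add_eq_0 add.commute)

lemma frob_diff: "frob (x - y) = frob x - frob y"
  using frob_add[of x "- y"] by (simp add: frob_minus)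

lemma frob_prod_list: "frob (prod_list xs) = prod_list (map frob xs)"
  by (induction xs) (auto simp: frob_mult)

lemma frob_eq_0_iff [simp]: "frob x = 0 \<longleftrightarrow> x = 0"
  by (simp add: frob_def card_gt_0_iff)

lemma inj_frob: "inj frob"
proof (rule injI)
  fix x y :: "'a alg_closure" assume "frob x = frob y"
  then have "frob (x - y) = 0"
    by (simp add: frob_diff)
  then show "x = y"
    by simp
qed

lemma inj_frob_funpow: "inj (frob ^^ n)"
  by (rule inj_fn[OF inj_frob])

lemma frob_funpow: "(frob ^^ n) (x :: 'a::{field,finite} alg_closure) = x ^ (card (UNIV :: 'a set) ^ n)"
  by (induction n) (auto simp: frob_def mult.commute simp flip: power_mult)

text \<open>The fixed points are the roots of X^(q^n) - X. Since q is 0 in the field, the derivative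
  is -1, so no root is repeated.\<close>

lemma card_frob_funpow_fixed:
  assumes "n > 0"
  shows "card {x :: 'a::{field,finite} alg_closure. (frob ^^ n) x = x} = card (UNIV :: 'a set) ^ n"
proof -
  define N where "N = card (UNIV :: 'a set) ^ n"
  define P where "P = Polynomial.monom (1 :: 'a alg_closure) N - Polynomial.monom 1 1"
  have "card (UNIV :: 'a set) ^ 1 \<le> N"
    unfolding N_def using assms card_field_ge_2[where ?'a = 'a] by (intro power_increasing) auto
  with card_field_ge_2[where ?'a = 'a] have N: "N \<ge> 2"
    by simp
  have degP: "degree P = N"
    unfolding P_def diff_conv_add_uminus using N
    by (subst degree_add_eq_left) (auto simp: degree_monom_eq)
  then have P0: "P \<noteq> 0"
    using N by auto
  have "of_nat (card (UNIV :: 'a set)) = (0 :: 'a alg_closure)"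
    by (metis of_nat_card_UNIV_eq_0 to_ac_0 to_ac_of_nat)
  then have "of_nat N = (0 :: 'a alg_closure)"
    using assms by (simp add: N_def zero_power)
  then have dP: "pderiv P = [:-1:]"
    by (simp add: P_def pderiv_diff pderiv_monom monom_0 one_pCons)
  obtain A where A: "size A = degree P" "P = Polynomial.smult (lead_coeff P) (\<Prod>x\<in>#A. [:-x, 1:])"
    using alg_closed_imp_factorization[OF P0] by blast
  have cnt: "count A x \<le> 1" for x
  proof (rule ccontr)
    assume "\<not> count A x \<le> 1"
    then have "replicate_mset 2 x \<subseteq># A"
      by (intro mset_subset_eqI) auto
    then obtain B where "A = {#x, x#} + B"
      by (metis mset_subset_eq_exists_conv numeral_2_eq_2 replicate_mset_0 replicate_mset_Suc)
    then obtain R where "P = [:-x, 1:] * ([:-x, 1:] * R)"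
      using A(2) by (metis (no_types, lifting) add_mset_add_single empty_neutral(1)
          image_mset_add_mset mult_smult_right prod_mset.add_mset union_mset_add_mset_left)
    then have "poly (pderiv P) x = 0"
      by (simp add: pderiv_mult del: mult_pCons_left)
    then show False
      by (simp add: dP)
  qed
  have "{x. poly P x = 0} = set_mset A"
    using P0 by (subst A(2)) (auto simp: poly_prod_mset prod_mset_zero_iff)
  moreover have "{x. (frob ^^ n) x = x} = {x. poly P x = 0}"
    by (auto simp: frob_funpow P_def N_def poly_monom)
  moreover have "card (set_mset A) = size A"
    using cnt by (simp add: size_multiset_overloaded_eq le_Suc_eq count_eq_zero_iff)
  ultimately show ?thesis
    using A(1) degP by (simp add: N_def)
qed

lemma finite_frob_funpow_fixed:
  "n > 0 \<Longrightarrow> finite {x :: 'a::{field,finite} alg_closure. (frob ^^ n) x = x}"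
  using card_frob_funpow_fixed[of n, where ?'a = 'a] card_field_ge_2[where ?'a = 'a]
  by (intro card_ge_0_finite) simp

text \<open>The base field consists of fixed points, and the count for n = 1 leaves room for no
  others.\<close>

lemma frob_fixed_iff: "frob x = x \<longleftrightarrow> x \<in> range to_ac" for x :: "'a::{field,finite} alg_closure"
proof -
  have "range to_ac = {x :: 'a alg_closure. (frob ^^ 1) x = x}"
    by (rule card_subset_eq[OF finite_frob_funpow_fixed])
       (use card_frob_funpow_fixed[of 1, where ?'a = 'a] in auto)
  then show ?thesis
    by auto
qed

subsection \<open>Irreducible polynomials and Frobenius orbits\<close>

lemma map_poly_add_hom:
  assumes "f 0 = 0" "\<And>x y. f (x + y) = f x + f y"
  shows "map_poly f (p + q) = map_poly f p + map_poly f q"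
  by (rule poly_eqI) (simp add: coeff_map_poly assms)

lemma map_poly_mult_hom:
  fixes f :: "'a::comm_semiring_0 \<Rightarrow> 'b::comm_semiring_0"
  assumes "f 0 = 0" "\<And>x y. f (x + y) = f x + f y" "\<And>x y. f (x * y) = f x * f y"
  shows "map_poly f (p * q) = map_poly f p * map_poly f q"
proof (rule poly_eqI)
  fix n
  have "f (sum g A) = (\<Sum>i\<in>A. f (g i))" for g and A :: "nat set"
    using assms by (induction A rule: infinite_finite_induct) auto
  then show "Polynomial.coeff (map_poly f (p * q)) n = Polynomial.coeff (map_poly f p * map_poly f q) n"
    by (simp add: coeff_map_poly assms coeff_mult)
qed

abbreviation ac_poly :: "'a::field poly \<Rightarrow> 'a alg_closure poly" where
  "ac_poly \<equiv> map_poly to_ac"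

lemma ac_poly_add: "ac_poly (p + q) = ac_poly p + ac_poly q"
  by (rule map_poly_add_hom) auto

lemma ac_poly_mult: "ac_poly (p * q) = ac_poly p * ac_poly q"
  by (rule map_poly_mult_hom) auto

lemma ac_poly_prod_list: "ac_poly (prod_list ps) = prod_list (map ac_poly ps)"
  by (induction ps) (auto simp: ac_poly_mult)

lemma degree_ac_poly [simp]: "degree (ac_poly p) = degree p"
  by (rule degree_map_poly) simp

lemma ac_poly_eq_iff [simp]: "ac_poly p = ac_poly q \<longleftrightarrow> p = q"
  by (auto simp: poly_eq_iff coeff_map_poly)

lemma ac_poly_eq_0_iff [simp]: "ac_poly p = 0 \<longleftrightarrow> p = 0"
  using ac_poly_eq_iff[of p 0] by (simp del: ac_poly_eq_iff)

lemma ac_poly_has_root: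
  assumes "degree (p :: 'a::field poly) > 0"
  obtains x where "poly (ac_poly p) x = 0"
  using alg_closed_imp_poly_has_root[of "ac_poly p"] assms by auto

lemma irreducible_poly_degree_pos: "Factorial_Ring.irreducible p \<Longrightarrow> degree p > 0"
  for p :: "'a::field poly"
  by (metis Factorial_Ring.irreducible_not_unit gr0I is_unit_iff_degree Factorial_Ring.irreducible_def)

lemma monic_dvd_eqI:
  fixes f g :: "'a::idom poly"
  assumes "f dvd g" "degree g \<le> degree f" "lead_coeff f = 1" "lead_coeff g = 1"
  shows "f = g"
proof -
  obtain k where k: "g = f * k"
    using assms(1) by (elim dvdE)
  have "f \<noteq> 0" "k \<noteq> 0"
    using k assms by auto
  then have "degree k = 0"
    using k assms(2) by (simp add: degree_mult_eq)
  then obtain c where "k = [:c:]"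
    by (elim degree_eq_zeroE)
  moreover have "lead_coeff k = 1"
    using k assms by (simp add: lead_coeff_mult)
  ultimately show ?thesis
    using k by simp
qed

text \<open>The minimal polynomial \<open>h\<close> of \<open>x\<close> divides every polynomial
  vanishing at \<open>x\<close>. As a nonunit divisor of the irreducible \<open>f\<close>, it is an
  associate of \<open>f\<close>.\<close>

lemma irreducible_dvd_of_common_root:
  fixes f g :: "'a::field poly"
  assumes f: "Factorial_Ring.irreducible f" and fx: "poly (ac_poly f) x = 0"
    and gx: "poly (ac_poly g) x = 0"
  shows "f dvd g"
proof -
  define Q where "Q = (\<lambda>h :: 'a poly. h \<noteq> 0 \<and> poly (ac_poly h) x = 0)"
  have "Q f"
    using f fx by (auto simp: Q_def)
  then obtain h where h: "Q h" "\<And>h'. degree h' < degree h \<Longrightarrow> \<not> Q h'"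
    using ex_has_least_nat[of Q f degree] by (metis not_less)
  have h_dvd: "h dvd k" if "poly (ac_poly k) x = 0" for k
  proof (rule ccontr)
    assume "\<not> h dvd k"
    then have "k mod h \<noteq> 0"
      by (simp add: mod_eq_0_iff_dvd)
    moreover have "poly (ac_poly (k div h * h + k mod h)) x = 0"
      using that by simp
    then have "poly (ac_poly (k mod h)) x = 0"
      using h(1) unfolding ac_poly_add ac_poly_mult by (simp add: Q_def)
    ultimately show False
      using h(2)[of "k mod h"] h(1) degree_mod_less'[of h k] by (auto simp: Q_def)
  qed
  have "\<not> is_unit h"
    using h(1) by (auto simp: Q_def is_unit_poly_iff map_poly_pCons)
  with irreducibleD'[OF f h_dvd[OF fx]] have "f dvd h"
    by blast
  then show ?thesis
    using h_dvd[OF gx] by (rule dvd_trans)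
qed

abbreviation linear_factors :: "'a::comm_ring_1 list \<Rightarrow> 'a poly" where
  "linear_factors xs \<equiv> (\<Prod>x\<leftarrow>xs. [:-x, 1:])"

lemma degree_linear_factors [simp]: "degree (linear_factors xs) = length (xs :: 'a::idom list)"
  and coeff_length_linear_factors [simp]: "Polynomial.coeff (linear_factors xs) (length xs) = 1"
proof -
  have "degree (linear_factors xs) = length xs \<and> lead_coeff (linear_factors xs) = 1"
  proof (induction xs)
    case (Cons x xs)
    then have "linear_factors xs \<noteq> 0"
      by auto
    then have "degree (linear_factors (x # xs)) = Suc (length xs)"
      using Cons by (simp add: degree_mult_eq del: mult_pCons_left)
    moreover have "lead_coeff ([:-x, 1:] * linear_factors xs) = 1"
      unfolding lead_coeff_mult conjunct2[OF Cons.IH] by simp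
    then have "lead_coeff (linear_factors (x # xs)) = 1"
      by (simp del: mult_pCons_left)
    ultimately show ?case
      by simp
  qed auto
  then show "degree (linear_factors xs) = length xs" "Polynomial.coeff (linear_factors xs) (length xs) = 1"
    by auto
qed

lemma poly_linear_factors_eq_0_iff: "poly (linear_factors xs) y = 0 \<longleftrightarrow> y \<in> set (xs :: 'a::idom list)"
  by (induction xs) auto

lemma linear_factors_mset_cong: "mset xs = mset ys \<Longrightarrow> linear_factors xs = linear_factors ys"
  by (metis mset_map prod_mset_prod_list)

lemma map_poly_frob_linear_factors:
  "map_poly frob (linear_factors xs) = linear_factors (map frob xs)"
proof (induction xs)
  case (Cons x xs)
  then show ?case
    by (simp add: map_poly_mult_hom frob_add frob_mult map_poly_pCons frob_minus del: mult_pCons_left)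
qed auto

text \<open>Galois descent: Frobenius permutes the roots, hence fixes every coefficient, and its
  fixed elements form the base field.\<close>

lemma frob_stable_linear_factors_descend:
  fixes xs :: "'a::{field,finite} alg_closure list"
  assumes "mset (map frob xs) = mset xs"
  obtains g :: "'a poly" where "ac_poly g = linear_factors xs" "lead_coeff g = 1" "degree g = length xs"
proof -
  let ?G = "linear_factors xs"
  have G: "map_poly frob ?G = ?G"
    unfolding map_poly_frob_linear_factors by (rule linear_factors_mset_cong[OF assms])
  have "frob (Polynomial.coeff ?G i) = Polynomial.coeff ?G i" for i
    using coeff_map_poly[of frob ?G i] by (simp add: G)
  then have co: "to_ac (of_ac (Polynomial.coeff ?G i)) = Polynomial.coeff ?G i" for i
    by (simp add: frob_fixed_iff to_ac_of_ac)
  define g where "g = map_poly of_ac ?G"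
  have g: "ac_poly g = ?G"
    by (rule poly_eqI) (simp add: g_def coeff_map_poly co)
  then have deg: "degree g = length xs"
    by (metis degree_ac_poly degree_linear_factors)
  have "to_ac (lead_coeff g) = lead_coeff ?G"
    by (simp add: deg coeff_map_poly flip: g)
  then have "lead_coeff g = 1"
    by simp
  with g deg show ?thesis
    by (rule_tac that)
qed

section \<open>Exact periods and orbits under Frobenius\<close>

definition has_period :: "nat \<Rightarrow> 'a::{field,finite} alg_closure \<Rightarrow> bool" where
  "has_period d x \<longleftrightarrow> d > 0 \<and> (frob ^^ d) x = x \<and> (\<forall>e. 0 < e \<and> e < d \<longrightarrow> (frob ^^ e) x \<noteq> x)"

lemma has_period_unique: "has_period d x \<Longrightarrow> has_period e x \<Longrightarrow> d = e"
  unfolding has_period_def by (metis linorder_neqE_nat)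

lemma ex_has_period:
  assumes "n > 0" "(frob ^^ n) x = x"
  obtains d where "has_period d x"
  using exists_least_iff[of "\<lambda>d. d > 0 \<and> (frob ^^ d) x = x"] assms
  unfolding has_period_def by blast

lemma funpow_fixed_mult: "(f ^^ d) x = x \<Longrightarrow> (f ^^ (d * k)) x = x"
  by (induction k) (auto simp: funpow_add)

text \<open>The remainder of \<open>n\<close> modulo \<open>d\<close> is again a return time of
  \<open>x\<close>, so by minimality of \<open>d\<close> it is 0.\<close>

lemma has_period_fixed_iff_dvd:
  assumes "has_period d x"
  shows "(frob ^^ n) x = x \<longleftrightarrow> d dvd n"
proof
  assume n: "(frob ^^ n) x = x"
  have "(frob ^^ (n mod d + d * (n div d))) x = x"
    using n by simp
  then have "(frob ^^ (n mod d)) x = x"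
    using assms funpow_fixed_mult[of d frob x "n div d"]
    unfolding funpow_add by (simp add: has_period_def)
  then show "d dvd n"
    using assms unfolding has_period_def by (metis gr0I mod_eq_0_iff_dvd mod_less_divisor)
qed (use assms in \<open>auto simp: has_period_def intro: funpow_fixed_mult\<close>)

lemma mset_rotate1: "mset (rotate1 xs) = mset xs"
  by (cases xs) auto

text \<open>A list rather than a set, so that Frobenius acts as \<open>rotate1\<close>: this gives
  the invariance needed for descent and, later, the sign of the cycle for the discriminant.\<close>

definition frob_orbit :: "nat \<Rightarrow> 'a::{field,finite} alg_closure \<Rightarrow> 'a alg_closure list" where
  "frob_orbit d x = map (\<lambda>i. (frob ^^ i) x) [0..<d]"

lemma length_frob_orbit [simp]: "length (frob_orbit d x) = d"
  by (simp add: frob_orbit_def)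

lemma map_frob_frob_orbit:
  assumes "has_period d x"
  shows "map frob (frob_orbit d x) = rotate1 (frob_orbit d x)"
proof -
  obtain e where e: "d = Suc e"
    using assms by (cases d) (auto simp: has_period_def)
  have "map frob (frob_orbit d x) = map (\<lambda>i. (frob ^^ i) x) [Suc 0..<Suc d]"
    unfolding frob_orbit_def map_Suc_upt[symmetric] by simp
  also have "\<dots> = map (\<lambda>i. (frob ^^ i) x) [Suc 0..<d] @ [x]"
    using assms e by (simp add: has_period_def)
  also have "\<dots> = rotate1 (frob_orbit d x)"
    unfolding frob_orbit_def e by (simp add: upt_conv_Cons del: upt_Suc)
  finally show ?thesis .
qed

lemma distinct_frob_orbit:
  assumes "has_period d x"
  shows "distinct (frob_orbit d x)"
proof -
  have "(frob ^^ i) x \<noteq> (frob ^^ j) x" if "i < j" "j < d" for i j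
  proof
    assume "(frob ^^ i) x = (frob ^^ j) x"
    also have "(frob ^^ j) x = (frob ^^ i) ((frob ^^ (j - i)) x)"
      using that by (simp flip: funpow_add comp_apply[of "frob ^^ i"])
    finally have "(frob ^^ (j - i)) x = x"
      using inj_frob_funpow[of i] by (metis injD)
    then show False
      using assms that by (auto simp: has_period_def)
  qed
  then have "inj_on (\<lambda>i. (frob ^^ i) x) {0..<d}"
    by (intro linorder_inj_onI) auto
  then show ?thesis
    by (simp add: frob_orbit_def distinct_map)
qed

lemma poly_ac_poly_frob: "poly (ac_poly p) (frob x) = frob (poly (ac_poly p) x)"
  by (induction p) (auto simp: map_poly_pCons frob_add frob_mult)

lemma poly_ac_poly_funpow_frob: "poly (ac_poly p) x = 0 \<Longrightarrow> poly (ac_poly p) ((frob ^^ i) x) = 0"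
  by (induction i) (auto simp: poly_ac_poly_frob)

text \<open>All iterates of \<open>x\<close> are roots of \<open>p\<close>, so two of them coincide;
  injectivity of Frobenius cancels the common part and makes \<open>x\<close> itself
  periodic.\<close>

lemma root_of_poly_has_period:
  fixes p :: "'a::{field,finite} poly"
  assumes "p \<noteq> 0" "poly (ac_poly p) x = 0"
  obtains d where "has_period d x"
proof -
  have "range (\<lambda>i. (frob ^^ i) x) \<subseteq> {y. poly (ac_poly p) y = 0}"
    using poly_ac_poly_funpow_frob[OF assms(2)] by auto
  then have "finite (range (\<lambda>i. (frob ^^ i) x))"
    using poly_roots_finite[of "ac_poly p"] assms(1) finite_subset by auto
  then have "\<not> inj (\<lambda>i. (frob ^^ i) x)"
    using finite_imageD by blast
  then obtain i j where ij: "i < j" "(frob ^^ i) x = (frob ^^ j) x"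
    unfolding inj_def by (metis linorder_neqE_nat)
  have "(frob ^^ j) x = (frob ^^ i) ((frob ^^ (j - i)) x)"
    using ij(1) by (simp flip: funpow_add comp_apply[of "frob ^^ i"])
  with ij have "(frob ^^ (j - i)) x = x"
    using inj_frob_funpow[of i] by (metis injD)
  then show ?thesis
    using ex_has_period[of "j - i" x] ij(1) that by auto
qed

section \<open>Monic irreducibles correspond to Frobenius orbits\<close>

definition monic_irreducibles :: "nat \<Rightarrow> 'a::field poly set" where
  "monic_irreducibles n = {f. lead_coeff f = 1 \<and> Factorial_Ring.irreducible f \<and> degree f = n}"

lemma orbit_roots_le_degree:
  assumes "p \<noteq> 0" "poly (ac_poly p) x = 0" "has_period d x"
  shows "d \<le> degree (p :: 'a::{field,finite} poly)"
proof -
  have "d = card (set (frob_orbit d x))"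
    using distinct_frob_orbit[OF assms(3)] by (simp add: distinct_card)
  also have "\<dots> \<le> card {y. poly (ac_poly p) y = 0}"
    using assms poly_ac_poly_funpow_frob by (intro card_mono poly_roots_finite) (auto simp: frob_orbit_def)
  also have "\<dots> \<le> degree (ac_poly p)"
    using assms by (intro card_poly_roots_bound) auto
  finally show ?thesis
    by simp
qed

text \<open>The orbit polynomial of \<open>x\<close> descends to some \<open>g\<close> over the base
  field, and \<open>f\<close> divides \<open>g\<close> by the common root. The orbit has at most
  \<open>n\<close> elements because they are all roots of \<open>f\<close>, so
  \<open>f = g\<close>.\<close>

lemma monic_irreducible_splits:
  fixes f :: "'a::{field,finite} poly"
  assumes f: "f \<in> monic_irreducibles n" and x: "poly (ac_poly f) x = 0"
  shows "has_period n x" "ac_poly f = linear_factors (frob_orbit n x)"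
proof -
  from f have irr: "Factorial_Ring.irreducible f" and monic: "lead_coeff f = 1" and deg: "degree f = n"
    by (auto simp: monic_irreducibles_def)
  have f0: "f \<noteq> 0"
    using irr by auto
  obtain d where d: "has_period d x"
    using root_of_poly_has_period[OF f0 x] .
  obtain g :: "'a poly" where g: "ac_poly g = linear_factors (frob_orbit d x)" "lead_coeff g = 1" "degree g = d"
    using frob_stable_linear_factors_descend[of "frob_orbit d x"] map_frob_frob_orbit[OF d]
    by (auto simp: mset_rotate1)
  have "x \<in> set (frob_orbit d x)"
    using d by (auto simp: frob_orbit_def has_period_def intro!: image_eqI[of _ _ 0])
  then have "poly (ac_poly g) x = 0"
    by (simp add: g poly_linear_factors_eq_0_iff)
  then have "f dvd g"
    by (rule irreducible_dvd_of_common_root[OF irr x])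
  moreover have "d \<le> n"
    using orbit_roots_le_degree[OF f0 x d] deg by simp
  ultimately have "f = g"
    using g monic deg by (intro monic_dvd_eqI) auto
  with g d deg show "has_period n x" "ac_poly f = linear_factors (frob_orbit n x)"
    by auto
qed

text \<open>The orbit polynomial works: a factor vanishing at \<open>x\<close> vanishes on the whole
  orbit and so has full degree, which leaves only a constant for the cofactor.\<close>

lemma ex_monic_irreducible_of_period:
  fixes x :: "'a::{field,finite} alg_closure"
  assumes "has_period n x"
  obtains f :: "'a poly" where "f \<in> monic_irreducibles n" "poly (ac_poly f) x = 0"
proof -
  obtain g :: "'a poly" where g: "ac_poly g = linear_factors (frob_orbit n x)" "lead_coeff g = 1" "degree g = n"
    using frob_stable_linear_factors_descend[of "frob_orbit n x"] map_frob_frob_orbit[OF assms]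
    by (auto simp: mset_rotate1)
  have n: "n > 0"
    using assms by (simp add: has_period_def)
  have "Factorial_Ring.irreducible g"
  proof (rule irreducibleI)
    show "g \<noteq> 0" "\<not> is_unit g"
      using g n by (auto simp: is_unit_poly_iff)
  next
    fix a b assume ab: "g = a * b"
    with g have ab0: "a \<noteq> 0" "b \<noteq> 0"
      by auto
    have deg: "degree a + degree b = n"
      using ab ab0 g(3) by (simp add: degree_mult_eq)
    have "x \<in> set (frob_orbit n x)"
      using n by (auto simp: frob_orbit_def intro!: image_eqI[of _ _ 0])
    then have "poly (ac_poly g) x = 0"
      by (simp add: g poly_linear_factors_eq_0_iff)
    then have "poly (ac_poly a) x = 0 \<or> poly (ac_poly b) x = 0"
      by (simp add: ab ac_poly_mult)
    then have "n \<le> degree a \<or> n \<le> degree b"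
      using orbit_roots_le_degree assms ab0 by blast
    with deg have "degree a = 0 \<or> degree b = 0"
      by auto
    then show "is_unit a \<or> is_unit b"
      using ab0 by (auto simp: is_unit_iff_degree)
  qed
  moreover have "x \<in> set (frob_orbit n x)"
    using n by (auto simp: frob_orbit_def intro!: image_eqI[of _ _ 0])
  ultimately show ?thesis
    using g that[of g] by (auto simp: monic_irreducibles_def poly_linear_factors_eq_0_iff)
qed

lemma monic_irreducible_roots:
  fixes f :: "'a::{field,finite} poly"
  assumes f: "f \<in> monic_irreducibles n"
  shows "card {x. poly (ac_poly f) x = 0} = n" "{x. poly (ac_poly f) x = 0} \<subseteq> {x. has_period n x}"
proof -
  have "degree f > 0"
    using f irreducible_poly_degree_pos by (auto simp: monic_irreducibles_def)
  then obtain x where x: "poly (ac_poly f) x = 0"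
    using ac_poly_has_root by blast
  from monic_irreducible_splits[OF f x]
  show "card {x. poly (ac_poly f) x = 0} = n"
    by (simp add: poly_linear_factors_eq_0_iff distinct_card distinct_frob_orbit)
  show "{x. poly (ac_poly f) x = 0} \<subseteq> {x. has_period n x}"
    using monic_irreducible_splits[OF f] by auto
qed

lemma monic_irreducible_eqI:
  fixes f g :: "'a::field poly"
  assumes "f \<in> monic_irreducibles m" "g \<in> monic_irreducibles n"
    and "poly (ac_poly f) x = 0" "poly (ac_poly g) x = 0"
  shows "f = g"
proof (rule monic_dvd_eqI)
  have fg: "f dvd g" "g dvd f"
    using assms irreducible_dvd_of_common_root by (auto simp: monic_irreducibles_def)
  show "f dvd g"
    by fact
  have "f \<noteq> 0"
    using assms(1) by (auto simp: monic_irreducibles_def)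
  with fg(2) show "degree g \<le> degree f"
    by (rule dvd_imp_degree_le)
qed (use assms in \<open>auto simp: monic_irreducibles_def\<close>)

section \<open>Counting monic irreducibles\<close>

lemma finite_has_period: "finite {x :: 'a::{field,finite} alg_closure. has_period n x}"
  by (cases "n = 0") (auto simp: has_period_def intro: finite_subset[OF _ finite_frob_funpow_fixed])

text \<open>A monic irreducible polynomial is determined by its root set, a subset of the finitely
  many elements of period \<open>n\<close>.\<close>

lemma finite_monic_irreducibles: "finite (monic_irreducibles n :: 'a::{field,finite} poly set)"
proof (rule finite_imageD)
  let ?R = "\<lambda>f :: 'a poly. {x. poly (ac_poly f) x = 0}"
  have "?R ` monic_irreducibles n \<subseteq> Pow {x. has_period n x}"
    using monic_irreducible_roots(2) by blast
  then show "finite (?R ` monic_irreducibles n)"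
    using finite_has_period finite_subset by blast
  show "inj_on ?R (monic_irreducibles n)"
  proof (rule inj_onI)
    fix f g :: "'a poly"
    assume f: "f \<in> monic_irreducibles n" and g: "g \<in> monic_irreducibles n" and eq: "?R f = ?R g"
    have "degree f > 0"
      using f irreducible_poly_degree_pos by (auto simp: monic_irreducibles_def)
    then obtain x where "poly (ac_poly f) x = 0"
      using ac_poly_has_root by blast
    with eq show "f = g"
      using monic_irreducible_eqI[OF f g] by blast
  qed
qed

text \<open>The root sets of the monic irreducibles of degree \<open>n\<close> partition the
  elements of period \<open>n\<close> into blocks of size \<open>n\<close>.\<close>

lemma card_has_period:
  "card {x :: 'a::{field,finite} alg_closure. has_period n x} = n * card (monic_irreducibles n :: 'a poly set)"
proof -
  let ?R = "\<lambda>f :: 'a poly. {x. poly (ac_poly f) x = 0}"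
  have "{x :: 'a alg_closure. has_period n x} = (\<Union>f\<in>monic_irreducibles n. ?R f)"
    using monic_irreducible_roots(2) ex_monic_irreducible_of_period by blast
  also have "card \<dots> = (\<Sum>f\<in>(monic_irreducibles n :: 'a poly set). card (?R f))"
  proof (rule card_UN_disjoint[OF finite_monic_irreducibles])
    show "\<forall>f\<in>monic_irreducibles n. finite (?R f)"
      using monic_irreducible_roots(2) finite_has_period finite_subset by blast
    show "\<forall>f\<in>monic_irreducibles n. \<forall>g\<in>monic_irreducibles n. f \<noteq> g \<longrightarrow> ?R f \<inter> ?R g = {}"
      using monic_irreducible_eqI by blast
  qed
  also have "\<dots> = n * card (monic_irreducibles n :: 'a poly set)"
    by (simp add: monic_irreducible_roots(1))
  finally show ?thesis .
qed

text \<open>Gauss's identity: the q^n fixed points of the \<open>n\<close>-th Frobenius power are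
  sorted by exact period, which ranges over the divisors of \<open>n\<close>.\<close>

lemma sum_degree_card_monic_irreducibles:
  assumes "n > 0"
  shows "(\<Sum>d | d dvd n. d * card (monic_irreducibles d :: 'a::{field,finite} poly set)) = card (UNIV :: 'a set) ^ n"
proof -
  have "{x :: 'a alg_closure. (frob ^^ n) x = x} = (\<Union>d\<in>{d. d dvd n}. {x. has_period d x})"
  proof (intro equalityI subsetI)
    fix x :: "'a alg_closure" assume "x \<in> {x. (frob ^^ n) x = x}"
    moreover from this obtain d where "has_period d x"
      using ex_has_period[OF assms, of x] by auto
    ultimately show "x \<in> (\<Union>d\<in>{d. d dvd n}. {x. has_period d x})"
      using has_period_fixed_iff_dvd[of d x n] by auto
  qed (auto simp: has_period_fixed_iff_dvd)
  moreover have "card \<dots> = (\<Sum>d | d dvd n. card {x :: 'a alg_closure. has_period d x})"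
  proof (rule card_UN_disjoint)
    show "finite {d. d dvd n}"
      using assms by simp
  qed (use finite_has_period has_period_unique in blast)+
  ultimately show ?thesis
    using card_frob_funpow_fixed[OF assms, where ?'a = 'a] by (simp add: card_has_period)
qed

subsection \<open>The number of irreducible polynomials modulo a prime\<close>

text \<open>Expand the \<open>l\<close>-th power of 1 + \<open>y\<close> binomially, where
  \<open>l ^ (b + 1)\<close> divides \<open>y\<close>. For 1 < k < l the binomial coefficient
  supplies one more factor \<open>l\<close>, giving exponent 2b + 3. The term k = l lacks that
  factor and needs \<open>l\<close> to be at least 3.\<close>

lemma odd_prime_power_step_cong:
  fixes x s :: int and l :: nat
  assumes "prime l" "odd l" and s: "int l ^ (b + 1) dvd s" and x: "[x = 1 + s] (mod int l ^ (b + 2))"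
  shows "[x ^ l = 1 + int l * s] (mod int l ^ (b + 3))"
proof -
  have l3: "l \<ge> 3"
    using assms prime_ge_2_nat[of l] by (cases "l = 2") auto
  from x obtain u where u: "x = 1 + s + int l ^ (b + 2) * u"
    by (metis cong_iff_lin add.commute cong_sym)
  define y where "y = s + int l ^ (b + 2) * u"
  have xy: "x = y + 1"
    using u by (simp add: y_def)
  have y: "int l ^ (b + 1) dvd y"
    using s by (simp add: y_def)
  have "int l ^ (b + 3) dvd int (l choose k) * y ^ k" if k: "2 \<le> k" "k \<le> l" for k
  proof (cases "k = l")
    case True
    have "(b + 1) * 3 \<le> (b + 1) * k"
      using l3 True by (intro mult_le_mono) auto
    then have "int l ^ (b + 3) dvd int l ^ ((b + 1) * k)"
      by (intro le_imp_power_dvd) simp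
    also have "\<dots> dvd y ^ k"
      unfolding power_mult by (rule dvd_power_same[OF y])
    finally show ?thesis
      by (rule dvd_mult)
  next
    case False
    then have "int l dvd int (l choose k)"
      using k dvd_choose_prime[of k l] \<open>prime l\<close> by simp
    moreover have "int l ^ ((b + 1) * k) dvd y ^ k"
      unfolding power_mult by (rule dvd_power_same[OF y])
    ultimately have "int l * int l ^ ((b + 1) * k) dvd int (l choose k) * y ^ k"
      by (rule mult_dvd_mono)
    moreover have "(b + 1) * 2 \<le> (b + 1) * k"
      using k by (intro mult_le_mono) auto
    then have "int l ^ (b + 3) dvd int l ^ Suc ((b + 1) * k)"
      by (intro le_imp_power_dvd) simp
    ultimately show ?thesis
      using dvd_trans by simp
  qed
  then have "int l ^ (b + 3) dvd (\<Sum>k\<in>{2..l}. int (l choose k) * y ^ k)"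
    by (intro dvd_sum) auto
  moreover have "x ^ l = 1 + int l * y + (\<Sum>k\<in>{2..l}. int (l choose k) * y ^ k)"
  proof -
    have "x ^ l = (\<Sum>k\<in>{..l}. int (l choose k) * y ^ k)"
      unfolding xy by (simp add: binomial_ring)
    also have "{..l} = insert 0 (insert 1 {2..l})"
      using l3 by auto
    finally show ?thesis
      by simp
  qed
  moreover have "int l * y = int l * s + int l ^ (b + 3) * u"
    by (simp add: y_def algebra_simps power_add power3_eq_cube power2_eq_square)
  ultimately show ?thesis
    by (auto simp: cong_iff_dvd_diff)
qed

text \<open>Each step in \<open>b\<close> raises to the \<open>l\<close>-th power and gains one
  power of \<open>l\<close>. The modulus stays one power beyond that of the linear term, so
  \<open>N * t\<close> remains visible modulo \<open>l\<close>.\<close>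

lemma one_plus_power_prime_power_cong:
  fixes t :: int and l :: nat
  assumes "prime l" "odd l"
  shows "[(1 + int l * t) ^ (N * l ^ b) = 1 + int N * int l ^ (b + 1) * t] (mod int l ^ (b + 2))"
proof (induction b)
  case 0
  show ?case
  proof (induction N)
    case (Suc N)
    have "[(1 + int l * t) * (1 + int l * t) ^ N = (1 + int l * t) * (1 + int N * int l * t)] (mod int l ^ 2)"
      using Suc by (intro cong_mult) (auto simp: power2_eq_square)
    also have "(1 + int l * t) * (1 + int N * int l * t) = 1 + int (Suc N) * int l * t + int l ^ 2 * (int N * t ^ 2)"
      by (simp add: algebra_simps power2_eq_square)
    also have "[1 + int (Suc N) * int l * t + int l ^ 2 * (int N * t ^ 2) = 1 + int (Suc N) * int l * t] (mod int l ^ 2)"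
      by (simp add: cong_iff_dvd_diff)
    finally show ?case
      by (simp add: power2_eq_square mult_ac)
  qed auto
next
  case (Suc b)
  have "[((1 + int l * t) ^ (N * l ^ b)) ^ l = 1 + int l * (int N * int l ^ (b + 1) * t)] (mod int l ^ (b + 3))"
    by (rule odd_prime_power_step_cong[OF assms _ Suc]) simp
  moreover have "((1 + int l * t) ^ (N * l ^ b)) ^ l = (1 + int l * t) ^ (N * l ^ Suc b)"
    by (simp add: mult_ac flip: power_mult)
  moreover have "1 + int l * (int N * int l ^ (b + 1) * t) = 1 + int N * int l ^ (Suc b + 1) * t"
    by simp
  moreover have "b + 3 = Suc b + 2"
    by simp
  ultimately show ?case
    by (simp only:)
qed

lemma divisors_mult_prime_power:
  fixes l b :: nat
  assumes "prime l" "\<not> l dvd b" "a > 0" "b > 0"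
  shows "{d. d dvd b * l ^ a} = {d. d dvd b * l ^ (a - 1)} \<union> (\<lambda>e. e * l ^ a) ` {e. e dvd b}"
    and "{d. d dvd b * l ^ (a - 1)} \<inter> (\<lambda>e. e * l ^ a) ` {e. e dvd b} = {}"
proof -
  have l: "l > 1"
    using assms prime_gt_1_nat by blast
  show "{d. d dvd b * l ^ a} = {d. d dvd b * l ^ (a - 1)} \<union> (\<lambda>e. e * l ^ a) ` {e. e dvd b}"
  proof (intro equalityI subsetI)
    fix d assume "d \<in> {d. d dvd b * l ^ a}"
    then obtain e f where ef: "d = e * f" "e dvd b" "f dvd l ^ a"
      using division_decomp by blast
    then obtain i where i: "f = l ^ i" "i \<le> a"
      using divides_primepow_nat assms(1) by blast
    show "d \<in> {d. d dvd b * l ^ (a - 1)} \<union> (\<lambda>e. e * l ^ a) ` {e. e dvd b}"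
    proof (cases "i = a")
      case False
      with i have "f dvd l ^ (a - 1)"
        by (auto intro: le_imp_power_dvd)
      with ef show ?thesis
        by (auto intro: mult_dvd_mono)
    qed (use ef i in auto)
  next
    fix d assume "d \<in> {d. d dvd b * l ^ (a - 1)} \<union> (\<lambda>e. e * l ^ a) ` {e. e dvd b}"
    moreover have "b * l ^ (a - 1) dvd b * l ^ a"
      by (intro mult_dvd_mono le_imp_power_dvd) auto
    moreover have "e * l ^ a dvd b * l ^ a" if "e dvd b" for e
      using that by (rule mult_dvd_mono) simp
    ultimately show "d \<in> {d. d dvd b * l ^ a}"
      using dvd_trans[of d "b * l ^ (a - 1)" "b * l ^ a"] by blast
  qed
  have False if "e dvd b" "e * l ^ a dvd b * l ^ (a - 1)" for e
  proof -
    have "l ^ a dvd b * l ^ (a - 1)"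
      using that(2) dvd_mult_right by blast
    moreover have "l ^ a = l * l ^ (a - 1)"
      using assms(3) by (simp flip: power_Suc)
    ultimately have "l * l ^ (a - 1) dvd b * l ^ (a - 1)"
      by simp
    then have "l dvd b"
      using l by simp
    with assms show False
      by blast
  qed
  then show "{d. d dvd b * l ^ (a - 1)} \<inter> (\<lambda>e. e * l ^ a) ` {e. e dvd b} = {}"
    by auto
qed

text \<open>
  Subtracting the hypothesis for \<open>n = b * l ^ (a - 1)\<close> from that for \<open>n = b * l ^ a\<close> leaves exactly the
  divisors \<open>e * l ^ a\<close> with \<open>e dvd b\<close>; the claim follows by Moebius inversion over these \<open>e\<close>, here in the
  form of an induction based on \<open>totient_divisor_sum\<close>.
\<close>
lemma necklace_count_cong:
  fixes q l :: nat and N :: "nat \<Rightarrow> nat"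
  assumes N: "\<And>n. n > 0 \<Longrightarrow> (\<Sum>d | d dvd n. d * N d) = q ^ n"
    and l: "prime l" "odd l" and q: "q = 1 + l * t" and a: "a > 0"
    and b: "b > 0" "\<not> l dvd b"
  shows "[int (b * N (b * l ^ a)) = - int (totient b * t)] (mod int l)"
  using b
proof (induction b rule: less_induct)
  case (less b)
  have lpos: "l > 0"
    using l prime_gt_0_nat by blast
  obtain a' where a': "a = Suc a'"
    using a by (cases a) auto
  let ?D = "{e. e dvd b}"
  let ?A = "{d. d dvd b * l ^ a'}"
  have split: "{d. d dvd b * l ^ a} = ?A \<union> (\<lambda>e. e * l ^ a) ` ?D" "?A \<inter> (\<lambda>e. e * l ^ a) ` ?D = {}"
    using divisors_mult_prime_power[OF l(1) less.prems(2) a less.prems(1)] a' by auto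
  have fin: "finite ?D" "finite ?A"
    using less.prems lpos by (auto intro!: finite_divisors_nat)
  have "q ^ (b * l ^ a) = (\<Sum>d | d dvd b * l ^ a. d * N d)"
    using N less.prems lpos by simp
  also have "\<dots> = (\<Sum>d\<in>?A. d * N d) + (\<Sum>d\<in>(\<lambda>e. e * l ^ a) ` ?D. d * N d)"
    unfolding split(1) using split(2) fin by (intro sum.union_disjoint) auto
  also have "(\<Sum>d\<in>?A. d * N d) = q ^ (b * l ^ a')"
    using N less.prems lpos by simp
  also have "(\<Sum>d\<in>(\<lambda>e. e * l ^ a) ` ?D. d * N d) = (\<Sum>e\<in>?D. e * l ^ a * N (e * l ^ a))"
    using lpos by (subst sum.reindex) (auto simp: inj_on_def)
  also have "\<dots> = l ^ a * (\<Sum>e\<in>?D. e * N (e * l ^ a))"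
    by (simp add: sum_distrib_left mult_ac)
  finally have "int (q ^ (b * l ^ a)) = int (q ^ (b * l ^ a') + l ^ a * (\<Sum>e\<in>?D. e * N (e * l ^ a)))"
    by (rule arg_cong)
  then have eq: "int q ^ (b * l ^ a) = int q ^ (b * l ^ a') + int l ^ a * int (\<Sum>e\<in>?D. e * N (e * l ^ a))"
    by (simp only: of_nat_add of_nat_mult of_nat_power)
  \<comment> \<open>For the larger exponent the linear term \<open>b * l ^ (a + 1) * t\<close>
    vanishes modulo \<open>l ^ (a + 1)\<close>. For the smaller one the term
    \<open>b * l ^ a * t\<close> survives; dividing the difference by \<open>l ^ a\<close> turns it
    into \<open>- b * t\<close>.\<close>
  have "[int q ^ (b * l ^ a) = 1 + int b * int l ^ (a + 1) * int t] (mod int l ^ (a + 2))"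
    using one_plus_power_prime_power_cong[OF l, of "int t" b a] by (simp add: q)
  then have "[int q ^ (b * l ^ a) = 1 + int b * int l ^ (a + 1) * int t] (mod int l ^ (a + 1))"
    by (rule cong_dvd_modulus) (simp add: le_imp_power_dvd)
  then have "int l ^ (a + 1) dvd (int q ^ (b * l ^ a) - (1 + int b * int l ^ (a + 1) * int t)) + int b * int l ^ (a + 1) * int t"
    unfolding cong_iff_dvd_diff by (rule dvd_add) simp
  then have q1: "int l ^ (a + 1) dvd int q ^ (b * l ^ a) - 1"
    by simp
  have q2: "int l ^ (a + 1) dvd int q ^ (b * l ^ a') - (1 + int b * int l ^ a * int t)"
    using one_plus_power_prime_power_cong[OF l, of "int t" b a'] by (simp add: q a' cong_iff_dvd_diff)
  from dvd_diff[OF q1 q2] have "int l ^ (a + 1) dvd int l ^ a * (int (\<Sum>e\<in>?D. e * N (e * l ^ a)) + int b * int t)"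
    by (simp add: eq algebra_simps)
  then have dvd: "int l dvd int (\<Sum>e\<in>?D. e * N (e * l ^ a)) + int b * int t"
    using lpos by simp
  have rem: "sum g ?D = g b + sum g (?D - {b})" for g :: "nat \<Rightarrow> nat"
    using fin by (intro sum.remove) auto
  have "[int (\<Sum>e\<in>?D - {b}. e * N (e * l ^ a)) = (\<Sum>e\<in>?D - {b}. - int (totient e * t))] (mod int l)"
    unfolding of_nat_sum
  proof (rule cong_sum)
    fix e assume "e \<in> ?D - {b}"
    then have "e < b" "e > 0" "\<not> l dvd e"
      using less.prems dvd_imp_le[of e b] by (auto intro: dvd_trans intro!: gr0I)
    then show "[int (e * N (e * l ^ a)) = - int (totient e * t)] (mod int l)"
      by (rule less.IH)
  qed
  then have dvd': "int l dvd int (\<Sum>e\<in>?D - {b}. e * N (e * l ^ a)) + int (\<Sum>e\<in>?D - {b}. totient e) * int t"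
    by (simp add: cong_iff_dvd_diff sum_negf sum_distrib_right)
  \<comment> \<open>The totients of all divisors of \<open>b\<close> sum to \<open>b\<close>, so
    removing the proper divisors, known by induction, from \<open>- b * t\<close> leaves exactly
    \<open>- totient b * t\<close>.\<close>
  have "b = totient b + (\<Sum>e\<in>?D - {b}. totient e)"
    using totient_divisor_sum[of b] rem[of totient] by simp
  then have "int b * int t = int (totient b) * int t + int (\<Sum>e\<in>?D - {b}. totient e) * int t"
    by (metis distrib_right of_nat_add)
  moreover have "int (\<Sum>e\<in>?D. e * N (e * l ^ a)) = int (b * N (b * l ^ a)) + int (\<Sum>e\<in>?D - {b}. e * N (e * l ^ a))"
    unfolding rem by (rule of_nat_add)
  ultimately have "int (b * N (b * l ^ a)) + int (totient b) * int t
    = (int (\<Sum>e\<in>?D. e * N (e * l ^ a)) + int b * int t)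
      - (int (\<Sum>e\<in>?D - {b}. e * N (e * l ^ a)) + int (\<Sum>e\<in>?D - {b}. totient e) * int t)"
    by linarith
  then have "int l dvd int (b * N (b * l ^ a)) + int (totient b) * int t"
    using dvd_diff[OF dvd dvd'] by metis
  then show ?case
    by (simp add: cong_iff_dvd_diff)
qed

text \<open>In the residue \<open>- totient b * t\<close> neither factor is divisible by
  \<open>l\<close>: \<open>totient b\<close> is positive and below \<open>l\<close> because
  \<open>b\<close> is, and \<open>l\<close> divides q - 1 only once.\<close>

lemma not_dvd_necklace_count:
  fixes q l :: nat and N :: "nat \<Rightarrow> nat"
  assumes N: "\<And>n. n > 0 \<Longrightarrow> (\<Sum>d | d dvd n. d * N d) = q ^ n"
    and l: "prime l" "odd l" "l dvd q - 1" "\<not> l ^ 2 dvd q - 1" and q: "q > 0"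
    and a: "a > 0" and b: "0 < b" "b < l"
  shows "\<not> l dvd N (b * l ^ a)"
proof
  assume dvd: "l dvd N (b * l ^ a)"
  obtain t where t: "q - 1 = l * t"
    using l(3) by (elim dvdE)
  with q have q': "q = 1 + l * t"
    by simp
  have "\<not> l dvd b"
    using b by (auto dest: dvd_imp_le)
  then have "[int (b * N (b * l ^ a)) = - int (totient b * t)] (mod int l)"
    using necklace_count_cong[OF N l(1,2) q' a b(1)] by blast
  moreover have "int l dvd int (b * N (b * l ^ a))"
    using dvd by simp
  ultimately have "int l dvd - int (totient b * t)"
    by (meson cong_dvd_iff cong_dvd_modulus dvd_refl)
  then have "l dvd totient b * t"
    by (simp flip: of_nat_mult)
  then have "l dvd totient b \<or> l dvd t"
    using l(1) by (simp add: prime_dvd_mult_iff)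
  moreover have "\<not> l dvd totient b"
    using b totient_le[of b] totient_gt_0_iff[of b] by (auto dest: dvd_imp_le)
  moreover have "\<not> l dvd t"
    using l(4) t by (auto simp: power2_eq_square)
  ultimately show False
    by blast
qed

text \<open>Split off the leading base \<open>l\<close> digit and recurse on the remainder
  \<open>r\<close>, which is still divisible by \<open>l\<close>, so no units digit occurs. The
  bound \<open>d \<le> m\<close> is carried along to show that the new part, at least
  \<open>l ^ a\<close> > \<open>r\<close>, differs from all later ones.\<close>

lemma ex_distinct_digit_parts:
  fixes l m :: nat
  assumes "l > 1" "l dvd m"
  shows "\<exists>D. finite D \<and> \<Sum>D = m \<and> (\<forall>d\<in>D. d \<le> m \<and> (\<exists>b a. d = b * l ^ a \<and> a > 0 \<and> 0 < b \<and> b < l))"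
  using assms(2)
proof (induction m rule: less_induct)
  case (less m)
  show ?case
  proof (cases "m = 0")
    case False
    obtain a where a: "l ^ a \<le> m" "m < l ^ Suc a"
      using ex_power_ivl1[of l m] False assms(1) by auto
    have "l \<le> m"
      using less.prems False by (auto dest: dvd_imp_le)
    with a have "a > 0"
      by (cases a) auto
    define b where "b = m div l ^ a"
    define r where "r = m mod l ^ a"
    have m: "m = b * l ^ a + r"
      unfolding b_def r_def by (rule div_mult_mod_eq[symmetric])
    have b: "0 < b" "b < l"
      using a assms(1) by (auto simp: b_def div_greater_zero_iff less_mult_imp_div_less)
    have r: "r < l ^ a"
      using assms(1) by (simp add: r_def)
    have "l dvd r"
      using less.prems \<open>a > 0\<close> by (simp add: r_def dvd_mod)
    moreover have "r < m"
      using r a by simp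
    ultimately obtain D where D: "finite D" "\<Sum>D = r"
      "\<forall>d\<in>D. d \<le> r \<and> (\<exists>b a. d = b * l ^ a \<and> a > 0 \<and> 0 < b \<and> b < l)"
      using less.IH by blast
    have "l ^ a \<le> b * l ^ a"
      using b by simp
    then have "b * l ^ a \<notin> D"
      using D(3) r by fastforce
    with D m b \<open>a > 0\<close> show ?thesis
      by (intro exI[of _ "insert (b * l ^ a) D"]) (auto intro: trans_le_add2)
  next
    case True
    then show ?thesis
      by (intro exI[of _ "{}"]) simp
  qed
qed

subsection \<open>Polynomials with prescribed factorization type\<close>

lemma poly_ac_poly_prod_list_eq_0_iff:
  "poly (ac_poly (prod_list ps)) z = 0 \<longleftrightarrow> (\<exists>p\<in>set ps. poly (ac_poly p) z = 0)"
  by (induction ps) (auto simp: ac_poly_mult)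

lemma poly_ac_poly_dvd: "p dvd q \<Longrightarrow> poly (ac_poly p) z = 0 \<Longrightarrow> poly (ac_poly q) z = 0"
  by (auto simp: ac_poly_mult elim!: dvdE)

text \<open>If the square of a nonconstant \<open>y\<close> divides the product, the factor
  \<open>p\<close> sharing a root with \<open>y\<close> divides \<open>y\<close>, so its square
  divides the product. The root then belongs to another factor as well, but distinct monic
  irreducibles have no common root.\<close>

lemma squarefree_prod_list_irreducible:
  fixes ps :: "'a::field poly list"
  assumes "distinct ps" and ps: "\<forall>p\<in>set ps. lead_coeff p = 1 \<and> Factorial_Ring.irreducible p"
  shows "squarefree (prod_list ps)"
proof (rule squarefreeI)
  fix y assume y2: "y ^ 2 dvd prod_list ps"
  have "prod_list ps \<noteq> 0"
    using ps by (auto simp: prod_list_zero_iff)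
  with y2 have "y \<noteq> 0"
    by auto
  show "y dvd 1"
  proof (rule ccontr)
    assume "\<not> y dvd 1"
    with \<open>y \<noteq> 0\<close> have "degree y > 0"
      by (simp add: is_unit_iff_degree)
    then obtain z where z: "poly (ac_poly y) z = 0"
      using ac_poly_has_root by blast
    have "y dvd prod_list ps"
      using y2 by (metis dvd_mult_left power2_eq_square)
    then obtain p where p: "p \<in> set ps" "poly (ac_poly p) z = 0"
      using poly_ac_poly_dvd[OF _ z] poly_ac_poly_prod_list_eq_0_iff by blast
    have irr: "Factorial_Ring.irreducible p"
      using p ps by blast
    have "p dvd y"
      by (rule irreducible_dvd_of_common_root[OF irr p(2) z])
    then have "p * p dvd prod_list ps"
      using y2 by (metis dvd_trans mult_dvd_mono power2_eq_square)
    also have "prod_list ps = p * prod_list (remove1 p ps)"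
      using p(1) by (induction ps) (auto simp: mult_ac)
    finally have "p dvd prod_list (remove1 p ps)"
      using irr by auto
    then obtain p' where p': "p' \<in> set (remove1 p ps)" "poly (ac_poly p') z = 0"
      using poly_ac_poly_dvd[OF _ p(2)] poly_ac_poly_prod_list_eq_0_iff by blast
    then have "p' \<in> set ps" "p' \<noteq> p"
      using \<open>distinct ps\<close> by auto
    moreover have "p = p'"
      using monic_irreducible_eqI[of p "degree p" p' "degree p'"] p p' ps \<open>p' \<in> set ps\<close>
      by (auto simp: monic_irreducibles_def)
    ultimately show False
      by simp
  qed
qed

lemma lead_coeff_prod_list_monic:
  fixes ps :: "'a::idom poly list"
  shows "\<forall>p\<in>set ps. lead_coeff p = 1 \<Longrightarrow> lead_coeff (prod_list ps) = 1"
  by (induction ps) (auto simp: lead_coeff_mult)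

lemma S_type_iff_has_fact_type: "f \<in> S_type lam \<longleftrightarrow> has_fact_type f lam"
  using squarefree_prod_list_irreducible lead_coeff_prod_list_monic
  unfolding S_type_def has_fact_type_def by blast

text \<open>With distinct parts the degree identifies each factor, so choosing one irreducible per
  degree and multiplying is a bijection.\<close>

lemma card_S_type_distinct_parts:
  assumes fin: "finite D"
  shows "card (S_type (mset_set D) :: 'a::field poly set) = (\<Prod>d\<in>D. card (monic_irreducibles d :: 'a poly set))"
proof -
  let ?I = "monic_irreducibles :: nat \<Rightarrow> 'a poly set"
  let ?P = "\<lambda>\<phi>. \<Prod>d\<in>D. \<phi> d :: 'a poly"
  have list: "?P \<phi> = prod_list (map \<phi> (sorted_list_of_set D))" for \<phi>
    using fin by (metis distinct_sorted_list_of_set prod.distinct_set_conv_list set_sorted_list_of_set)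
  have "bij_betw ?P (Pi\<^sub>E D ?I) (S_type (mset_set D))"
    unfolding bij_betw_def
  proof (intro conjI inj_onI equalityI subsetI)
    fix \<phi> \<psi> assume phi: "\<phi> \<in> Pi\<^sub>E D ?I" and psi: "\<psi> \<in> Pi\<^sub>E D ?I" and eq: "?P \<phi> = ?P \<psi>"
    show "\<phi> = \<psi>"
    proof (rule PiE_ext[OF phi psi])
      fix d assume d: "d \<in> D"
      then have "\<phi> d \<in> ?I d"
        using phi by blast
      then have "degree (\<phi> d) > 0"
        using irreducible_poly_degree_pos[of "\<phi> d"] by (simp add: monic_irreducibles_def)
      \<comment> \<open>Unique factorization through roots: a root of \<phi> \<open>d\<close> is a
        root of some \<psi> \<open>e\<close>, the two irreducibles coincide, and comparing degrees
        gives \<open>d = e\<close>.\<close>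
      then obtain z where z: "poly (ac_poly (\<phi> d)) z = 0"
        using ac_poly_has_root by blast
      then have "poly (ac_poly (?P \<phi>)) z = 0"
        unfolding list using d fin by (auto simp: poly_ac_poly_prod_list_eq_0_iff)
      then have "poly (ac_poly (?P \<psi>)) z = 0"
        by (simp only: eq)
      then obtain e where e: "e \<in> D" "poly (ac_poly (\<psi> e)) z = 0"
        using fin by (auto simp: list poly_ac_poly_prod_list_eq_0_iff)
      have psi_e: "\<psi> e \<in> ?I e"
        using psi e by blast
      have "\<phi> d = \<psi> e"
        by (rule monic_irreducible_eqI[OF \<open>\<phi> d \<in> ?I d\<close> psi_e z e(2)])
      moreover from this have "d = e"
        using \<open>\<phi> d \<in> ?I d\<close> psi_e by (auto simp: monic_irreducibles_def)
      ultimately show "\<phi> d = \<psi> d"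
        by simp
    qed
  next
    fix f assume "f \<in> ?P ` Pi\<^sub>E D ?I"
    then obtain \<phi> where phi: "\<phi> \<in> Pi\<^sub>E D ?I" "f = ?P \<phi>"
      by blast
    let ?ps = "map \<phi> (sorted_list_of_set D)"
    have deg: "degree (\<phi> d) = d" if "d \<in> D" for d
      using phi that by (auto simp: monic_irreducibles_def)
    have "inj_on \<phi> D"
      by (metis deg inj_onI)
    then have "distinct ?ps"
      using fin by (simp add: distinct_map)
    moreover have "\<forall>p\<in>set ?ps. lead_coeff p = 1 \<and> Factorial_Ring.irreducible p"
      using phi fin by (auto simp: monic_irreducibles_def)
    moreover have "mset (map degree ?ps) = mset_set D"
    proof -
      have "map degree ?ps = sorted_list_of_set D"
        unfolding map_map using fin deg by (intro map_idI) auto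
      then show ?thesis
        using fin by (metis mset_sorted_list_of_multiset sorted_list_of_mset_set)
    qed
    ultimately show "f \<in> S_type (mset_set D)"
      unfolding S_type_iff_has_fact_type has_fact_type_def using phi(2) list by blast
  next
    fix f :: "'a poly" assume "f \<in> S_type (mset_set D)"
    then obtain ps where ps: "distinct ps" "\<forall>p\<in>set ps. lead_coeff p = 1 \<and> Factorial_Ring.irreducible p"
      "f = prod_list ps" "mset (map degree ps) = mset_set D"
      unfolding S_type_iff_has_fact_type has_fact_type_def by blast
    have "distinct (map degree ps)"
      using ps(4) by (metis count_mset_set(1,3) distinct_count_atmost_1 mset_eq_setD fin finite_set_mset_mset_set set_mset_mset)
    then have inj: "inj_on degree (set ps)"
      by (simp add: distinct_map)
    have D: "D = degree ` set ps"
      using ps(4) fin by (metis finite_set_mset_mset_set set_map set_mset_mset)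
    \<comment> \<open>The factor of each degree is recovered by inverting \<open>degree\<close>;
      \<open>restrict\<close> supplies the default value outside \<open>D\<close> that
      \<open>Pi\<^sub>E\<close> demands.\<close>
    define \<phi> where "\<phi> = restrict (inv_into (set ps) degree) D"
    have phi: "\<phi> (degree p) = p" if "p \<in> set ps" for p
      using that inj by (simp add: \<phi>_def D)
    have "?P \<phi> = (\<Prod>p\<in>set ps. p)"
      unfolding D using inj phi by (subst prod.reindex) auto
    also have "\<dots> = f"
      using ps by (simp add: prod.distinct_set_conv_list)
    finally have "f = ?P \<phi>"
      by simp
    moreover have "\<phi> \<in> Pi\<^sub>E D ?I"
      using ps(2) phi by (auto simp: D monic_irreducibles_def PiE_iff extensional_def) (auto simp: \<phi>_def D)
    ultimately show "f \<in> ?P ` Pi\<^sub>E D ?I"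
      by blast
  qed
  then have "card (S_type (mset_set D) :: 'a poly set) = card (Pi\<^sub>E D ?I)"
    by (metis bij_betw_same_card)
  then show ?thesis
    using fin by (simp add: card_PiE)
qed

subsection \<open>The quadratic character of the discriminant\<close>

text \<open>The Vandermonde product, a square root of the discriminant of a monic polynomial with
  these roots. Its sign depends on their order, so a list is used.\<close>

fun diff_prod :: "'a::comm_ring_1 list \<Rightarrow> 'a" where
  "diff_prod [] = 1"
| "diff_prod (x # xs) = (\<Prod>y\<leftarrow>xs. x - y) * diff_prod xs"

lemma prod_list_map_mult: "(\<Prod>x\<leftarrow>xs. f x * g x) = (\<Prod>x\<leftarrow>xs. f x) * (\<Prod>x\<leftarrow>xs. g x :: 'a::comm_monoid_mult)"
  by (induction xs) (auto simp: mult_ac)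

lemma prod_list_map_mset_cong:
  "mset xs = mset ys \<Longrightarrow> (\<Prod>x\<leftarrow>xs. f x) = (\<Prod>x\<leftarrow>ys. f x :: 'a::comm_monoid_mult)"
  by (metis mset_map prod_mset_prod_list)

lemma prod_list_diff_swap: "(\<Prod>y\<leftarrow>xs. y - x) = (-1) ^ length xs * (\<Prod>y\<leftarrow>xs. x - y :: 'a::comm_ring_1)"
proof (induction xs)
  case (Cons y xs)
  then show ?case
    by (simp add: algebra_simps)
qed auto

lemma diff_prod_append:
  "diff_prod (xs @ ys) = diff_prod xs * diff_prod ys * (\<Prod>x\<leftarrow>xs. \<Prod>y\<leftarrow>ys. x - y)"
  by (induction xs) (auto simp: mult_ac)

text \<open>Every entry that \<open>x\<close> jumps over on its way to the front reverses one
  difference.\<close>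

lemma diff_prod_middle:
  "diff_prod (xs @ x # ys) = (-1) ^ length xs * diff_prod (x # xs @ ys)"
  by (simp add: diff_prod_append prod_list_map_mult prod_list_diff_swap mult_ac)

text \<open>Bring the head of \<open>xs\<close> to the front of \<open>ys\<close>; the sign this
  costs disappears on squaring.\<close>

lemma diff_prod_square_mset_cong: "mset xs = mset ys \<Longrightarrow> diff_prod xs ^ 2 = diff_prod ys ^ 2"
proof (induction xs arbitrary: ys)
  case (Cons x xs)
  then obtain us vs where ys: "ys = us @ x # vs"
    by (metis list.set_intros(1) mset_eq_setD split_list)
  then have "mset xs = mset (us @ vs)"
    using Cons.prems by simp
  then have "diff_prod xs ^ 2 = diff_prod (us @ vs) ^ 2" "(\<Prod>y\<leftarrow>xs. x - y) = (\<Prod>y\<leftarrow>us @ vs. x - y)"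
    using Cons.IH prod_list_map_mset_cong by blast+
  then show ?case
    unfolding ys diff_prod_middle by (simp add: power_mult_distrib power_even_eq[symmetric] flip: power_mult)
qed auto

lemma prod_square_diff_eq_diff_prod:
  "(\<Prod>(i, j)\<in>{(i, j). i < j \<and> j < length rs}. (rs ! i - rs ! j) ^ 2) = diff_prod rs ^ 2"
proof (induction rs)
  case (Cons r rs)
  let ?A = "{(i, j). i < j \<and> j < length rs}"
  have fin: "finite ?A"
    by (rule finite_subset[of _ "{..<length rs} \<times> {..<length rs}"]) auto
  \<comment> \<open>Pairs with first index 0 give the differences with the head \<open>r\<close>;
    the remaining pairs are those of the tail with both indices shifted.\<close>
  have split: "{(i, j). i < j \<and> j < length (r # rs)}
    = (\<lambda>j. (0, Suc j)) ` {..<length rs} \<union> (\<lambda>(i, j). (Suc i, Suc j)) ` ?A"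
  proof (intro equalityI subsetI)
    fix z assume "z \<in> {(i, j). i < j \<and> j < length (r # rs)}"
    then obtain i j where "z = (i, Suc j)" "i < Suc j" "j < length rs"
      by (cases z; cases "snd z") auto
    then show "z \<in> (\<lambda>j. (0, Suc j)) ` {..<length rs} \<union> (\<lambda>(i, j). (Suc i, Suc j)) ` ?A"
      by (cases i) (auto simp: image_iff)
  qed auto
  have "(\<Prod>(i, j)\<in>{(i, j). i < j \<and> j < length (r # rs)}. ((r # rs) ! i - (r # rs) ! j) ^ 2)
    = (\<Prod>j<length rs. (r - rs ! j) ^ 2) * (\<Prod>(i, j)\<in>?A. (rs ! i - rs ! j) ^ 2)"
    unfolding split using fin
    by (subst prod.union_disjoint) (auto simp: prod.reindex inj_on_def case_prod_unfold)
  also have "(\<Prod>j<length rs. (r - rs ! j) ^ 2) = (\<Prod>y\<leftarrow>rs. r - y) ^ 2"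
    using prod.list_conv_set_nth[of "map (\<lambda>y. r - y) rs"]
    by (simp add: atLeast0LessThan prod_power_distrib)
  finally show ?case
    using Cons by (simp add: power_mult_distrib)
qed auto

lemma diff_prod_neq_0: "distinct xs \<Longrightarrow> diff_prod xs \<noteq> (0 :: 'a::idom)"
  by (induction xs) (auto simp: prod_list_zero_iff)

lemma frob_diff_prod: "frob (diff_prod xs) = diff_prod (map frob xs)"
  by (induction xs) (auto simp: frob_mult frob_prod_list frob_diff o_def)

text \<open>The sign of a full cycle: the head passes every other entry. Truncated subtraction makes
  the exponent 0 for the empty list.\<close>

lemma diff_prod_rotate1: "diff_prod (rotate1 xs) = (-1) ^ (length xs - 1) * diff_prod xs"
  by (cases xs) (use diff_prod_middle[of _ _ "[]"] in auto)

text \<open>Each block contributes the sign of its cycle, while the differences between a block and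
  the rest are merely permuted among themselves.\<close>

lemma frob_diff_prod_concat_cycles:
  assumes "\<forall>rs\<in>set rss. map frob rs = rotate1 rs"
  shows "frob (diff_prod (concat rss)) = (-1) ^ (\<Sum>rs\<leftarrow>rss. length rs - 1) * diff_prod (concat rss)"
  using assms
proof (induction rss)
  case (Cons rs rss)
  let ?R = "concat rss"
  have rot: "map frob rs = rotate1 rs"
    using Cons.prems by simp
  have R: "mset (map frob ?R) = mset ?R"
    using Cons.prems by (induction rss) (auto simp: mset_rotate1 simp del: mset_map)
  have "(\<Prod>x\<leftarrow>map frob rs. \<Prod>y\<leftarrow>map frob ?R. x - y) = (\<Prod>x\<leftarrow>map frob rs. \<Prod>y\<leftarrow>?R. x - y)"
    using prod_list_map_mset_cong[OF R] by metis
  also have "\<dots> = (\<Prod>x\<leftarrow>rs. \<Prod>y\<leftarrow>?R. x - y)"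
    unfolding rot by (rule prod_list_map_mset_cong[OF mset_rotate1])
  finally have res: "(\<Prod>x\<leftarrow>map frob rs. \<Prod>y\<leftarrow>map frob ?R. x - y) = (\<Prod>x\<leftarrow>rs. \<Prod>y\<leftarrow>?R. x - y)" .
  have "frob (diff_prod (rs @ ?R)) = diff_prod (map frob rs @ map frob ?R)"
    by (simp only: frob_diff_prod map_append)
  also have "\<dots> = diff_prod (map frob rs) * diff_prod (map frob ?R) * (\<Prod>x\<leftarrow>rs. \<Prod>y\<leftarrow>?R. x - y)"
    unfolding diff_prod_append res ..
  also have "diff_prod (map frob ?R) = (-1) ^ (\<Sum>rs\<leftarrow>rss. length rs - 1) * diff_prod ?R"
    using Cons by (simp add: frob_diff_prod)
  also have "diff_prod (map frob rs) = (-1) ^ (length rs - 1) * diff_prod rs"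
    unfolding rot by (rule diff_prod_rotate1)
  finally show ?case
    by (simp add: diff_prod_append power_add mult_ac)
qed auto

text \<open>Cancel one common root at a time. This controls the list of roots that
  \<open>SOME\<close> picks in \<open>disc_ac\<close>, which is determined only up to order.\<close>

lemma linear_factors_inject:
  "linear_factors xs = linear_factors ys \<Longrightarrow> mset xs = mset (ys :: 'a::idom list)"
proof (induction xs arbitrary: ys)
  case Nil
  then have "degree (linear_factors ys) = 0"
    by (metis degree_1 prod_list.Nil list.map(1))
  then show ?case
    by simp
next
  case (Cons x xs)
  then have "x \<in> set ys"
    using poly_linear_factors_eq_0_iff[of "x # xs" x] poly_linear_factors_eq_0_iff[of ys x] by simp
  then obtain us vs where ys: "ys = us @ x # vs"
    by (meson split_list)
  have "[:-x, 1:] * linear_factors xs = [:-x, 1:] * linear_factors (us @ vs)"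
    using Cons.prems by (simp add: ys mult_ac del: mult_pCons_left mult_pCons_right)
  then have "linear_factors xs = linear_factors (us @ vs)"
    by (metis mult_cancel_left pCons_eq_0_iff one_neq_zero)
  then have "mset xs = mset (us @ vs)"
    by (rule Cons.IH)
  then show ?case
    by (simp add: ys)
qed

lemma disc_of_linear_factors:
  fixes f :: "'a::field poly"
  assumes f: "lead_coeff f = 1" "ac_poly f = linear_factors rs"
  shows "disc f = of_ac (diff_prod rs ^ 2)"
proof -
  have deg: "degree f = length rs"
    using f(2) by (metis degree_ac_poly degree_linear_factors)
  let ?Q = "\<lambda>rs. length rs = degree f \<and> ac_poly f = Polynomial.smult (to_ac (lead_coeff f)) (linear_factors rs)"
  define rs' where "rs' = (SOME rs. ?Q rs)"
  have "?Q rs"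
    using f deg by simp
  then have "?Q rs'"
    unfolding rs'_def by (rule someI)
  then have rs': "length rs' = degree f" "linear_factors rs' = linear_factors rs"
    using f by auto
  have "disc_ac f = (\<Prod>(i, j)\<in>{(i, j). i < j \<and> j < degree f}. (rs' ! i - rs' ! j) ^ 2)"
    unfolding disc_ac_def Let_def rs'_def[symmetric] using f(1) by simp
  also have "\<dots> = diff_prod rs' ^ 2"
    using prod_square_diff_eq_diff_prod[of rs'] rs'(1) by simp
  also have "\<dots> = diff_prod rs ^ 2"
    using linear_factors_inject[OF rs'(2)] by (rule diff_prod_square_mset_cong)
  finally show ?thesis
    by (simp add: disc_def)
qed

section \<open>Stickelberger's theorem and the quadratic classes\<close>

lemma two_neq_0_of_odd_card:
  assumes "odd (card (UNIV :: 'a::{field,finite} set))"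
  shows "(2 :: 'a) \<noteq> 0"
proof
  assume "(2 :: 'a) = 0"
  obtain k where "card (UNIV :: 'a set) = 2 * k + 1"
    using assms by (elim oddE)
  then have "of_nat (card (UNIV :: 'a set)) = (1 :: 'a)"
    using \<open>(2 :: 'a) = 0\<close> by simp
  then show False
    by (simp add: of_nat_card_UNIV_eq_0)
qed

lemma sum_list_pred:
  "\<forall>x\<in>set xs. x > 0 \<Longrightarrow> (\<Sum>x\<leftarrow>xs. x - 1) + length xs = sum_list (xs :: nat list)"
  by (induction xs) auto

text \<open>The Vandermonde product \<open>V\<close> of the roots squares to the discriminant, and
  Frobenius multiplies it by the sign of its action on the roots, one cycle per irreducible factor.
  The discriminant is a square in the base field exactly when Frobenius fixes
  \<open>V\<close>.\<close>

lemma stickelberger_quad_char_disc: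
  fixes f :: "'a::{field,finite} poly"
  assumes odd_q: "odd (card (UNIV :: 'a set))" and f: "f \<in> S_type lam"
  shows "disc f \<noteq> 0" "quad_char (disc f) = (-1) ^ (sum_mset lam - size lam)"
proof -
  obtain ps where ps: "distinct ps" "\<forall>p\<in>set ps. lead_coeff p = 1 \<and> Factorial_Ring.irreducible p"
    "f = prod_list ps" "mset (map degree ps) = lam"
    using f unfolding S_type_iff_has_fact_type has_fact_type_def by blast
  have pos: "\<forall>p\<in>set ps. degree p > 0"
    using ps(2) irreducible_poly_degree_pos by blast
  have "\<exists>z. poly (ac_poly p) z = 0" if "p \<in> set ps" for p
    using pos that ac_poly_has_root by metis
  then obtain z where z: "\<And>p. p \<in> set ps \<Longrightarrow> poly (ac_poly p) (z p) = 0"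
    by metis
  define orb where "orb = (\<lambda>p. frob_orbit (degree p) (z p))"
  have orb: "has_period (degree p) (z p)" "ac_poly p = linear_factors (orb p)" if "p \<in> set ps" for p
    using monic_irreducible_splits[of p "degree p" "z p"] that ps(2) z
    by (auto simp: monic_irreducibles_def orb_def)
  define rss where "rss = map orb ps"
  define rs where "rs = concat rss"
  define V where "V = diff_prod rs"
  have "ac_poly f = prod_list (map (\<lambda>p. linear_factors (orb p)) ps)"
    unfolding ps(3) ac_poly_prod_list using orb(2) by (metis (mono_tags, lifting) map_eq_conv)
  also have "\<dots> = linear_factors rs"
    unfolding rs_def rss_def by (induction ps) auto
  finally have f_rs: "ac_poly f = linear_factors rs" .
  have cyc: "\<forall>rs\<in>set rss. map frob rs = rotate1 rs"
    using orb(1) by (auto simp: rss_def orb_def map_frob_frob_orbit)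
  have "distinct rs"
  proof -
    \<comment> \<open>Generalized to lists of factors from \<open>ps\<close> for the induction;
      orbits with a common element come from the same irreducible factor.\<close>
    have "distinct (concat (map orb qs))" if "distinct qs" "set qs \<subseteq> set ps" for qs
      using that
    proof (induction qs)
      case (Cons p qs)
      have "set (orb p) \<inter> set (orb r) = {}" if "r \<in> set qs" for r
      proof -
        have "p = r" if "y \<in> set (orb p)" "y \<in> set (orb r)" for y
          using that orb(2)[of p] orb(2)[of r] \<open>r \<in> set qs\<close> Cons.prems ps(2)
          by (intro monic_irreducible_eqI[of p "degree p" r "degree r" y])
             (auto simp: monic_irreducibles_def poly_linear_factors_eq_0_iff)
        with Cons.prems \<open>r \<in> set qs\<close> show ?thesis
          by auto
      qed
      moreover have "distinct (orb p)"
        using orb(1)[of p] Cons.prems by (simp add: orb_def distinct_frob_orbit)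
      ultimately show ?case
        using Cons by auto
    qed auto
    then show ?thesis
      using ps(1) by (simp add: rs_def rss_def)
  qed
  then have V0: "V \<noteq> 0"
    by (simp add: V_def diff_prod_neq_0)
  \<comment> \<open>All degrees are positive, so none of the subtractions is truncated.\<close>
  have "(\<Sum>rs\<leftarrow>rss. length rs - 1) + size lam = sum_mset lam"
  proof -
    have "(\<Sum>rs\<leftarrow>rss. length rs - 1) = (\<Sum>x\<leftarrow>map degree ps. x - 1)"
      by (simp add: rss_def orb_def o_def)
    moreover have "size lam = length (map degree ps)" "sum_mset lam = sum_list (map degree ps)"
      unfolding ps(4)[symmetric] by (simp, rule sum_mset_sum_list)
    ultimately show ?thesis
      using sum_list_pred[of "map degree ps"] pos by simp
  qed
  then have exp: "(\<Sum>rs\<leftarrow>rss. length rs - 1) = sum_mset lam - size lam"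
    by simp
  have frobV: "frob V = (-1) ^ (sum_mset lam - size lam) * V"
    using frob_diff_prod_concat_cycles[OF cyc] unfolding exp V_def rs_def .
  then have "frob (V ^ 2) = V ^ 2"
    by (simp add: power2_eq_square frob_mult mult_ac flip: power_add mult_2)
  then have "V ^ 2 \<in> range to_ac"
    by (simp only: frob_fixed_iff)
  moreover have "disc f = of_ac (V ^ 2)"
    unfolding V_def using f f_rs by (intro disc_of_linear_factors) (auto simp: S_type_def)
  ultimately have disc: "to_ac (disc f) = V ^ 2"
    by (simp add: to_ac_of_ac)
  with V0 show nz: "disc f \<noteq> 0"
    by (metis power_eq_0_iff to_ac_0)
  show "quad_char (disc f) = (-1) ^ (sum_mset lam - size lam)"
  proof (cases "even (sum_mset lam - size lam)")
    case True
    with frobV have "frob V = V"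
      by simp
    then obtain y where "V = to_ac y"
      using frob_fixed_iff by blast
    with disc have "y ^ 2 = disc f"
      by (metis to_ac_eq_iff to_ac_power)
    with nz True show ?thesis
      by (auto simp: quad_char_def)
  next
    case False
    \<comment> \<open>A square root \<open>y\<close> in the base field would equal \<open>V\<close>
      up to sign, so Frobenius would fix \<open>V\<close> while also negating it; this is impossible
      in odd characteristic.\<close>
    have "y ^ 2 \<noteq> disc f" for y
    proof
      assume "y ^ 2 = disc f"
      with disc have "to_ac y ^ 2 = V ^ 2"
        by (metis to_ac_power)
      then have "V = to_ac y \<or> V = to_ac (- y)"
        by (auto simp: power2_eq_iff)
      then have "frob V = V"
        by (auto simp: frob_minus)
      with False frobV have "V = - V"
        by simp
      then have "2 * V = 0"
        by (metis add_eq_0_iff2 mult_2)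
      with V0 have "to_ac (2 :: 'a) = 0"
        by simp
      then show False
        using two_neq_0_of_odd_card[OF odd_q] by (simp only: to_ac_eq_0_iff)
    qed
    with nz False show ?thesis
      by (auto simp: quad_char_def)
  qed
qed

text \<open>Squaring is two-to-one on the nonzero elements, so half of them are squares and the
  other half are not.\<close>

lemma card_quad_char_class:
  assumes odd_q: "odd (card (UNIV :: 'a::{field,finite} set))" and s: "s \<in> {1, -1}"
  shows "2 * card {c :: 'a. c \<noteq> 0 \<and> quad_char c = s} = card (UNIV :: 'a set) - 1"
proof -
  let ?S = "{c :: 'a. c \<noteq> 0 \<and> quad_char c = 1}" and ?N = "{c :: 'a. c \<noteq> 0 \<and> quad_char c = -1}"
  have two: "(2 :: 'a) \<noteq> 0"
    by (rule two_neq_0_of_odd_card[OF odd_q])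
  have "UNIV - {0 :: 'a} = (\<Union>c\<in>?S. {y. y ^ 2 = c})"
    by (auto simp: quad_char_def)
  also have "card \<dots> = (\<Sum>c\<in>?S. card {y :: 'a. y ^ 2 = c})"
    by (intro card_UN_disjoint) auto
  also have "\<dots> = (\<Sum>c\<in>?S. 2)"
  proof (rule sum.cong)
    fix c :: 'a assume "c \<in> ?S"
    then obtain y where y: "y ^ 2 = c" "y \<noteq> 0"
      by (auto simp: quad_char_def split: if_splits)
    have "{x. x ^ 2 = c} = {y, - y}"
      using y(1) by (auto simp: power2_eq_iff)
    moreover have "y \<noteq> - y"
      using two y(2) by (metis add_eq_0_iff2 mult_2 mult_eq_0_iff)
    ultimately show "card {x. x ^ 2 = c} = 2"
      by simp
  qed auto
  finally have S: "2 * card ?S = card (UNIV :: 'a set) - 1"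
    by (simp add: card_Diff_singleton)
  have "UNIV - {0 :: 'a} = ?S \<union> ?N"
    by (auto simp: quad_char_def)
  moreover have "card (?S \<union> ?N) = card ?S + card ?N"
    by (rule card_Un_disjoint) auto
  ultimately have "card (UNIV :: 'a set) - 1 = card ?S + card ?N"
    by (metis card_Diff_singleton iso_tuple_UNIV_I)
  with S s show ?thesis
    by auto
qed

subsection \<open>Equidistribution of discriminants\<close>

lemma mset_set_is_partition:
  assumes "finite D" "0 \<notin> D"
  shows "is_partition (\<Sum>D) (mset_set D)"
  using assms unfolding is_partition_def by (auto simp: sum_unfold_sum_mset intro!: gr0I)

text \<open>The discriminant maps \<open>S_type lam\<close> into a class \<open>C\<close> with
  equally large fibres, so \<open>card C\<close> divides its cardinality. As
  \<open>2 * card C\<close> is q - 1 and \<open>l\<close> is odd, \<open>l\<close> divides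
  \<open>card C\<close>.\<close>

lemma odd_prime_dvd_card_S_type:
  fixes m l :: nat
  assumes odd_q: "odd (card (UNIV :: 'a::{field,finite} set))"
    and lam: "sum_mset lam = m" and fin: "finite (S_type lam :: 'a poly set)"
    and equi: "\<forall>c1 c2 :: 'a. c1 \<noteq> 0 \<and> c2 \<noteq> 0 \<and>
                  quad_char c1 = (-1) ^ (m - size lam) \<and>
                  quad_char c2 = (-1) ^ (m - size lam) \<longrightarrow>
                  card {f \<in> (S_type lam :: 'a poly set). disc f = c1} =
                  card {f \<in> (S_type lam :: 'a poly set). disc f = c2}"
    and l: "prime l" "odd l" "l dvd card (UNIV :: 'a set) - 1"
  shows "l dvd card (S_type lam :: 'a poly set)"
proof -
  let ?S = "S_type lam :: 'a poly set"
  define s :: int where "s = (-1) ^ (m - size lam)"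
  define C where "C = {c :: 'a. c \<noteq> 0 \<and> quad_char c = s}"
  have "s \<in> {1, -1}"
    by (auto simp: s_def minus_one_power_iff)
  then have "2 * card C = card (UNIV :: 'a set) - 1"
    unfolding C_def by (rule card_quad_char_class[OF odd_q])
  with l(3) have "l dvd 2 * card C"
    by simp
  moreover have "coprime l 2"
    using l(2) by simp
  ultimately have "l dvd card C"
    using coprime_dvd_mult_right_iff by blast
  have "disc f \<in> C" if "f \<in> ?S" for f
    using stickelberger_quad_char_disc[OF odd_q that] lam by (simp add: C_def s_def)
  then have "?S = (\<Union>c\<in>C. {f \<in> ?S. disc f = c})"
    by auto
  then have "card ?S = card (\<Union>c\<in>C. {f \<in> ?S. disc f = c})"
    by (rule arg_cong)
  also have "\<dots> = (\<Sum>c\<in>C. card {f \<in> ?S. disc f = c})"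
    using fin by (intro card_UN_disjoint) auto
  finally have sum: "card ?S = (\<Sum>c\<in>C. card {f \<in> ?S. disc f = c})" .
  show ?thesis
  proof (cases "C = {}")
    case False
    then obtain c0 where c0: "c0 \<in> C"
      by blast
    have "(\<Sum>c\<in>C. card {f \<in> ?S. disc f = c}) = (\<Sum>c\<in>C. card {f \<in> ?S. disc f = c0})"
    proof (rule sum.cong)
      fix c assume "c \<in> C"
      with c0 show "card {f \<in> ?S. disc f = c} = card {f \<in> ?S. disc f = c0}"
        by (intro equi[rule_format]) (simp add: C_def s_def)
    qed simp
    with sum \<open>l dvd card C\<close> show ?thesis
      by simp
  qed (use sum in simp)
qed

text \<open>The digit parts of \<open>m\<close> serve if \<open>l\<close> divides \<open>m\<close>.
  Otherwise those of \<open>m - 1\<close> are joined by a part 1, which is new because they are all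
  multiples of \<open>l\<close>.\<close>

lemma ex_partition_not_dvd_card_S_type:
  fixes m l :: nat
  assumes l: "prime l" "odd l" "l dvd card (UNIV :: 'a::{field,finite} set) - 1"
    "\<not> l ^ 2 dvd card (UNIV :: 'a set) - 1"
    and m: "l dvd m \<or> l dvd m - 1" "m > 0"
  obtains lam where "is_partition m lam" "\<not> l dvd card (S_type lam :: 'a poly set)"
proof -
  let ?q = "card (UNIV :: 'a set)"
  let ?N = "\<lambda>d. card (monic_irreducibles d :: 'a poly set)"
  have l1: "l > 1"
    using l(1) prime_gt_1_nat by blast
  have q: "?q \<ge> 2"
    by (rule card_field_ge_2)
  have parts: "d \<noteq> 0 \<and> \<not> l dvd ?N d" if d: "\<exists>b a. d = b * l ^ a \<and> a > 0 \<and> 0 < b \<and> b < l" for d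
  proof -
    obtain a b where ab: "d = b * l ^ a" "a > 0" "0 < b" "b < l"
      using d by blast
    have "\<not> l dvd ?N (b * l ^ a)"
    proof (rule not_dvd_necklace_count[where q = ?q])
      show "(\<Sum>d | d dvd n. d * ?N d) = ?q ^ n" if "n > 0" for n
        using that by (rule sum_degree_card_monic_irreducibles)
    qed (use l ab q in auto)
    with ab l1 show ?thesis
      by simp
  qed
  \<comment> \<open>There are q monic linear polynomials, and q is 1 modulo
    \<open>l\<close>.\<close>
  have one: "\<not> l dvd ?N 1"
  proof -
    have "?N 1 = ?q"
      using sum_degree_card_monic_irreducibles[of 1, where ?'a = 'a] by simp
    moreover have "\<not> l dvd ?q"
      using l(3) q l1 dvd_diff_nat[of l ?q "?q - 1"] by auto
    ultimately show ?thesis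
      by simp
  qed
  obtain D where D: "finite D" "\<Sum>D = m" "0 \<notin> D" "\<forall>d\<in>D. \<not> l dvd ?N d"
  proof (cases "l dvd m")
    case True
    obtain D where "finite D" "\<Sum>D = m"
      "\<forall>d\<in>D. d \<le> m \<and> (\<exists>b a. d = b * l ^ a \<and> a > 0 \<and> 0 < b \<and> b < l)"
      using ex_distinct_digit_parts[OF l1 True] by blast
    then show ?thesis
      using parts by (intro that[of D]) blast+
  next
    case False
    with m have m1: "l dvd m - 1"
      by blast
    obtain D where D: "finite D" "\<Sum>D = m - 1"
      "\<forall>d\<in>D. d \<le> m - 1 \<and> (\<exists>b a. d = b * l ^ a \<and> a > 0 \<and> 0 < b \<and> b < l)"
      using ex_distinct_digit_parts[OF l1 m1] by blast
    have "1 \<notin> D"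
      using D(3) l1 by auto
    with D m(2) have "\<Sum>(insert 1 D) = m"
      by simp
    moreover have "\<forall>d\<in>D. d \<noteq> 0 \<and> \<not> l dvd ?N d"
      using D(3) parts by blast
    then have "0 \<notin> insert 1 D" "\<forall>d\<in>insert 1 D. \<not> l dvd ?N d"
      using one by auto
    ultimately show ?thesis
      using D(1) by (intro that[of "insert 1 D"]) auto
  qed
  show ?thesis
  proof (rule that)
    show "is_partition m (mset_set D)"
      using mset_set_is_partition[OF D(1,3)] D(2) by simp
    show "\<not> l dvd card (S_type (mset_set D) :: 'a poly set)"
      unfolding card_S_type_distinct_parts[OF D(1)]
      using D(1,4) l(1) by (simp add: prime_dvd_prod_iff)
  qed
qed

theorem theorem5p1:
  fixes m :: nat
  assumes odd_q: "odd (card (UNIV :: 'a::{field,finite} set))"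
    and sqf: "squarefree (card (UNIV :: 'a set) - 1)"
    and m2: "m \<ge> 2"
    and eq: "\<forall>lam. is_partition m lam \<longrightarrow>
              (\<forall>c1 c2 :: 'a. c1 \<noteq> 0 \<and> c2 \<noteq> 0 \<and>
                  quad_char c1 = (-1) ^ (m - size lam) \<and>
                  quad_char c2 = (-1) ^ (m - size lam) \<longrightarrow>
                  card {f \<in> (S_type lam :: 'a poly set). disc f = c1} =
                  card {f \<in> (S_type lam :: 'a poly set). disc f = c2})"
  shows "gcd (card (UNIV :: 'a set) - 1) (m * (m - 1)) = 2"
proof (rule ccontr)
  assume neq: "gcd (card (UNIV :: 'a set) - 1) (m * (m - 1)) \<noteq> 2"
  define g where "g = gcd (card (UNIV :: 'a set) - 1) (m * (m - 1))"
  have "2 dvd g"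
    using odd_q m2 by (auto simp: g_def)
  then obtain h where h: "g = 2 * h"
    by (elim dvdE)
  with neq have "h \<noteq> 1"
    by (auto simp: g_def)
  \<comment> \<open>Taking the prime from \<open>h\<close> rather than from \<open>g\<close> gives
    \<open>2 * l\<close> as a divisor of q - 1; for \<open>l = 2\<close> this would be a square,
    which rules out that prime.\<close>
  then obtain l where l: "prime l" "l dvd h"
    using prime_factor_nat by blast
  have "g dvd card (UNIV :: 'a set) - 1" "g dvd m * (m - 1)"
    by (auto simp: g_def)
  with l h have dvd: "l dvd card (UNIV :: 'a set) - 1" "l dvd m * (m - 1)" "2 * l dvd card (UNIV :: 'a set) - 1"
    by (auto intro: dvd_trans mult_dvd_mono)
  have sq: "\<not> l ^ 2 dvd card (UNIV :: 'a set) - 1"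
    using squarefreeD[OF sqf, of l] l(1) by auto
  have "l \<noteq> 2"
    using dvd(3) sq by (auto simp: power2_eq_square)
  with l(1) have "odd l"
    using primes_dvd_imp_eq two_is_prime_nat by blast
  have "l dvd m \<or> l dvd m - 1"
    using dvd(2) l(1) by (simp add: prime_dvd_mult_iff)
  moreover have "m > 0"
    using m2 by simp
  ultimately obtain lam where lam: "is_partition m lam" "\<not> l dvd card (S_type lam :: 'a poly set)"
    by (rule ex_partition_not_dvd_card_S_type[OF l(1) \<open>odd l\<close> dvd(1) sq])
  \<comment> \<open>An infinite set would have \<open>card\<close> equal to 0, which
    \<open>l\<close> divides.\<close>
  have "finite (S_type lam :: 'a poly set)"
    using lam(2) by (intro card_ge_0_finite) (auto intro!: gr0I)
  moreover have "sum_mset lam = m"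
    using lam(1) by (simp add: is_partition_def)
  ultimately have "l dvd card (S_type lam :: 'a poly set)"
    using odd_prime_dvd_card_S_type[OF odd_q _ _ _ l(1) \<open>odd l\<close> dvd(1)] eq lam(1) by blast
  with lam(2) show False
    by blast
qed

end
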